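(* Let $\Gamma$ be a (discrete) group with commuting cyclic conjugates. Then $\Gamma$ is $\mathfrak{X}^{\mathrm{sep}}$-boundedly acyclic, i.e. $H^n_b(\Gamma;E)=0$ for all $n\ge 1$ and every separable dual Banach $\Gamma$-module $E$.
   Context: **Commuting cyclic conjugates.** A group $\Gamma$ has commuting cyclic conjugates if for every finitely generated subgroup $H\le\Gamma$ there exist $t\in\Gamma$ and $n\in\mathbb{N}_{\ge 2}\cup\{\infty\}$ such that (1) $[H,t^pHt^{-p}]=1$ for all integers $1\le p<n$; (2) $[H,t^n]=1$, where one reads $t^\infty=1$. (Here $[A,B]=1$ means every element of $A$ commutes with every element of $B$.) **Bounded cohomology.** All groups are discrete. A Banach $\Gamma$-module is a real Banach space $E$ with an action of $\Gamma$ by linear isometries. $C^k_b(\Gamma;E)$ is the space of bounded functions $\Gamma^{k+1}\to E$, with the action $(\gamma\cdot f)(\gamma_0,\dots,\gamma_k)=\gamma f(\gamma^{-1}\gamma_0,\dots,\gamma^{-1}\gamma_k)$ and coboundary $\delta f(g_0,\dots,g_{k+1})=\sum_i(-1)^i f(g_0,\dots,\widehat{g_i},\dots,g_{k+1})$. $H^\bullet_b(\Gamma;E)$ is the cohomology of the complex $C^\bullet_b(\Gamma;E)^\Gamma$ of invariants. $E$ is dual if it is isometrically $\Gamma$-isomorphic to the dual of some Banach $\Gamma$-module (with the contragredient action); separable means norm-separable. *)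

theory Defs
  imports "HOL-Analysis.Analysis" "HOL-Algebra.Algebra"
begin

section \<open>Commuting cyclic conjugates\<close>

definition finitely_generated_subgroup :: "('g, 'm) monoid_scheme \<Rightarrow> 'g set \<Rightarrow> bool"
  where "finitely_generated_subgroup G H \<longleftrightarrow>
    (\<exists>S. finite S \<and> S \<subseteq> carrier G \<and> H = generate G S)"

definition commuting_sets :: "('g, 'm) monoid_scheme \<Rightarrow> 'g set \<Rightarrow> 'g set \<Rightarrow> bool"
  where "commuting_sets G A B \<longleftrightarrow> (\<forall>a\<in>A. \<forall>b\<in>B. a \<otimes>\<^bsub>G\<^esub> b = b \<otimes>\<^bsub>G\<^esub> a)"

text \<open>Powers with an exponent that may be infinite, under the convention \<open>t\<^sup>\<infinity> = 1\<close>.\<close>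

definition enat_pow :: "('g, 'm) monoid_scheme \<Rightarrow> 'g \<Rightarrow> enat \<Rightarrow> 'g"
  where "enat_pow G t n = (case n of enat k \<Rightarrow> t [^]\<^bsub>G\<^esub> k | \<infinity> \<Rightarrow> \<one>\<^bsub>G\<^esub>)"

definition commuting_cyclic_conjugates :: "('g, 'm) monoid_scheme \<Rightarrow> bool"
  where "commuting_cyclic_conjugates G \<longleftrightarrow>
    (\<forall>H. finitely_generated_subgroup G H \<longrightarrow>
      (\<exists>t\<in>carrier G. \<exists>n::enat. 2 \<le> n \<and>
        (\<forall>p::nat. 1 \<le> p \<and> enat p < n \<longrightarrow>
          commuting_sets G H ((t [^]\<^bsub>G\<^esub> p <#\<^bsub>G\<^esub> H) #>\<^bsub>G\<^esub> inv\<^bsub>G\<^esub> (t [^]\<^bsub>G\<^esub> p))) \<and>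
        commuting_sets G H {enat_pow G t n}))"


section \<open>Banach modules and their duals\<close>

locale banach_module = group G
  for G :: "('g, 'm) monoid_scheme" (structure) +
  fixes act :: "'g \<Rightarrow> 'e::banach \<Rightarrow> 'e"
  assumes act_one: "act \<one> x = x"
    and act_mult: "g \<in> carrier G \<Longrightarrow> h \<in> carrier G \<Longrightarrow> act (g \<otimes> h) x = act g (act h x)"
    and act_linear: "g \<in> carrier G \<Longrightarrow> linear (act g)"
    and act_isometric: "g \<in> carrier G \<Longrightarrow> norm (act g x) = norm x"

definition contragredient ::
    "('g, 'm) monoid_scheme \<Rightarrow> ('g \<Rightarrow> 'f::banach \<Rightarrow> 'f) \<Rightarrow> 'g \<Rightarrow> ('f \<Rightarrow>\<^sub>L real) \<Rightarrow> ('f \<Rightarrow>\<^sub>L real)"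
  where "contragredient G act g \<phi> = Blinfun (\<lambda>x. blinfun_apply \<phi> (act (inv\<^bsub>G\<^esub> g) x))"

definition isometric_module_iso ::
    "('g, 'm) monoid_scheme \<Rightarrow> ('g \<Rightarrow> 'e::banach \<Rightarrow> 'e) \<Rightarrow> ('g \<Rightarrow> 'f::banach \<Rightarrow> 'f) \<Rightarrow>
      ('e \<Rightarrow> 'f) \<Rightarrow> bool"
  where "isometric_module_iso G act act' \<Phi> \<longleftrightarrow>
    linear \<Phi> \<and> bij \<Phi> \<and> (\<forall>x. norm (\<Phi> x) = norm x) \<and>
    (\<forall>g\<in>carrier G. \<forall>x. \<Phi> (act g x) = act' g (\<Phi> x))"

text \<open>The predual is an argument, since HOL cannot quantify over its type.  In a hypothesis of a
  theorem in which the predual and its type are free, this expresses that some predual exists.\<close>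

definition dual_banach_module ::
    "('g, 'm) monoid_scheme \<Rightarrow> ('g \<Rightarrow> 'e::banach \<Rightarrow> 'e) \<Rightarrow> ('g \<Rightarrow> 'f::banach \<Rightarrow> 'f) \<Rightarrow> bool"
  where "dual_banach_module G act pre \<longleftrightarrow>
    banach_module G act \<and> banach_module G pre \<and>
    (\<exists>\<Phi>. isometric_module_iso G act (contragredient G pre) \<Phi>)"

lemma (in banach_module) act_inv_bounded_linear:
  assumes "g \<in> carrier G"
  shows "bounded_linear (\<lambda>x. blinfun_apply \<phi> (act (inv g) x))"
proof -
  have "bounded_linear (act (inv g))"
    using act_linear[of "inv g"] act_isometric[of "inv g"] assms
    by (intro bounded_linear.intro bounded_linear_axioms.intro)
       (auto intro!: exI[of _ 1])
  then show ?thesis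
    by (rule bounded_linear_compose[OF blinfun.bounded_linear_right])
qed

lemma (in banach_module) contragredient_apply:
  assumes "g \<in> carrier G"
  shows "blinfun_apply (contragredient G act g \<phi>) x = blinfun_apply \<phi> (act (inv g) x)"
  unfolding contragredient_def
  by (simp add: bounded_linear_Blinfun_apply act_inv_bounded_linear[OF assms])

lemma (in banach_module) banach_module_contragredient:
  "banach_module G (contragredient G act)"
proof (intro banach_module.intro banach_module_axioms.intro group_axioms)
  fix g h \<phi>
  show "contragredient G act \<one> \<phi> = \<phi>"
    by (rule blinfun_eqI) (simp add: contragredient_apply act_one)
  assume g: "g \<in> carrier G"
  show "h \<in> carrier G \<Longrightarrow>
      contragredient G act (g \<otimes> h) \<phi> = contragredient G act g (contragredient G act h \<phi>)"
    using g by (intro blinfun_eqI) (simp add: contragredient_apply inv_mult_group act_mult)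
  show "linear (contragredient G act g)"
    by (intro linearI blinfun_eqI)
       (use g in \<open>simp_all add: contragredient_apply blinfun.add_left blinfun.scaleR_left\<close>)
  have le: "norm (contragredient G act k \<psi>) \<le> norm \<psi>" if "k \<in> carrier G" for k \<psi>
  proof (rule norm_blinfun_bound)
    fix x
    have "norm (blinfun_apply \<psi> (act (inv k) x)) \<le> norm \<psi> * norm (act (inv k) x)"
      by (rule norm_blinfun)
    then show "norm (blinfun_apply (contragredient G act k \<psi>) x) \<le> norm \<psi> * norm x"
      using that by (simp add: contragredient_apply act_isometric)
  qed simp
  have "contragredient G act (inv g) (contragredient G act g \<phi>) = \<phi>"
    using g by (intro blinfun_eqI)
      (simp add: contragredient_apply act_mult[symmetric] act_one)
  then show "norm (contragredient G act g \<phi>) = norm \<phi>"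
    using le[OF g, of \<phi>] le[of "inv g" "contragredient G act g \<phi>"] g by simp
qed


section \<open>Bounded cohomology\<close>

text \<open>A cochain of degree \<open>k\<close> is a function on tuples, represented by lists of length \<open>k + 1\<close> over
  the carrier; outside of these it is required to be zero, so that cochains are determined by their
  values on tuples.\<close>

definition tuples :: "('g, 'm) monoid_scheme \<Rightarrow> nat \<Rightarrow> 'g list set"
  where "tuples G k = {gs. length gs = Suc k \<and> set gs \<subseteq> carrier G}"

definition omit_nth :: "nat \<Rightarrow> 'a list \<Rightarrow> 'a list"
  where "omit_nth i xs = take i xs @ drop (Suc i) xs"

definition bounded_cochains ::
    "('g, 'm) monoid_scheme \<Rightarrow> nat \<Rightarrow> ('g list \<Rightarrow> 'e::banach) set"
  where "bounded_cochains G k =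
    {f. bounded (f ` tuples G k) \<and> (\<forall>gs. gs \<notin> tuples G k \<longrightarrow> f gs = 0)}"

definition cochain_act ::
    "('g, 'm) monoid_scheme \<Rightarrow> ('g \<Rightarrow> 'e::banach \<Rightarrow> 'e) \<Rightarrow> nat \<Rightarrow> 'g \<Rightarrow> ('g list \<Rightarrow> 'e) \<Rightarrow> 'g list \<Rightarrow> 'e"
  where "cochain_act G act k \<gamma> f gs =
    (if gs \<in> tuples G k then act \<gamma> (f (map (\<lambda>g. inv\<^bsub>G\<^esub> \<gamma> \<otimes>\<^bsub>G\<^esub> g) gs)) else 0)"

definition coboundary ::
    "('g, 'm) monoid_scheme \<Rightarrow> nat \<Rightarrow> ('g list \<Rightarrow> 'e::banach) \<Rightarrow> 'g list \<Rightarrow> 'e"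
  where "coboundary G k f gs =
    (if gs \<in> tuples G (Suc k) then \<Sum>i\<le>Suc k. (- 1) ^ i *\<^sub>R f (omit_nth i gs) else 0)"

text \<open>The additive group of the invariants of the bounded \<open>k\<close>-cochains.\<close>

definition invariant_cochains ::
    "('g, 'm) monoid_scheme \<Rightarrow> ('g \<Rightarrow> 'e::banach \<Rightarrow> 'e) \<Rightarrow> nat \<Rightarrow> ('g list \<Rightarrow> 'e) monoid"
  where "invariant_cochains G act k =
    \<lparr>carrier = {f \<in> bounded_cochains G k. \<forall>\<gamma>\<in>carrier G. cochain_act G act k \<gamma> f = f},
     mult = (\<lambda>f f' gs. f gs + f' gs),
     one = (\<lambda>gs. 0)\<rparr>"

definition bounded_cocycles ::
    "('g, 'm) monoid_scheme \<Rightarrow> ('g \<Rightarrow> 'e::banach \<Rightarrow> 'e) \<Rightarrow> nat \<Rightarrow> ('g list \<Rightarrow> 'e) set"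
  where "bounded_cocycles G act k =
    kernel (invariant_cochains G act k) (invariant_cochains G act (Suc k)) (coboundary G k)"

definition bounded_coboundaries ::
    "('g, 'm) monoid_scheme \<Rightarrow> ('g \<Rightarrow> 'e::banach \<Rightarrow> 'e) \<Rightarrow> nat \<Rightarrow> ('g list \<Rightarrow> 'e) set"
  where "bounded_coboundaries G act k =
    (case k of 0 \<Rightarrow> {\<lambda>gs. 0} | Suc m \<Rightarrow> coboundary G m ` carrier (invariant_cochains G act m))"

text \<open>Only the additive group of the real vector space \<open>H\<^sup>k\<close> is retained.\<close>

definition bounded_cohomology ::
    "('g, 'm) monoid_scheme \<Rightarrow> ('g \<Rightarrow> 'e::banach \<Rightarrow> 'e) \<Rightarrow> nat \<Rightarrow> ('g list \<Rightarrow> 'e) set monoid"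
  where "bounded_cohomology G act k =
    (invariant_cochains G act k)\<lparr>carrier := bounded_cocycles G act k\<rparr>
      Mod bounded_coboundaries G act k"

lemma omit_nth_tuples:
  assumes "gs \<in> tuples G (Suc k)" "i \<le> Suc k"
  shows "omit_nth i gs \<in> tuples G k"
  using assms set_take_subset[of i gs] set_drop_subset[of "Suc i" gs]
  by (auto simp: tuples_def omit_nth_def)

lemma omit_nth_omit_nth:
  assumes "i \<le> j" "j < length xs - 1"
  shows "omit_nth j (omit_nth i xs) = omit_nth i (omit_nth (Suc j) xs)"
  using assms by (intro nth_equalityI) (auto simp: omit_nth_def nth_append min_def)

lemma coboundary_coboundary: "coboundary G (Suc k) (coboundary G k f) = (\<lambda>gs. 0)"
proof
  fix gs
  show "coboundary G (Suc k) (coboundary G k f) gs = 0"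
  proof (cases "gs \<in> tuples G (Suc (Suc k))")
    case True
    define F where "F = (\<lambda>(i, j). ((- 1) ^ (i + j) :: real) *\<^sub>R f (omit_nth j (omit_nth i gs)))"
    define A where "A = {(i, j). i \<le> Suc (Suc k) \<and> j \<le> Suc k \<and> i \<le> j}"
    define B where "B = {(i, j). i \<le> Suc (Suc k) \<and> j \<le> Suc k \<and> j < i}"
    have AB: "{..Suc (Suc k)} \<times> {..Suc k} = A \<union> B" "A \<inter> B = {}"
      by (auto simp: A_def B_def)
    have fin: "finite A" "finite B"
      by (rule finite_subset[of _ "{..Suc (Suc k)} \<times> {..Suc k}"]; auto simp: A_def B_def)+
    have "sum F B = sum (\<lambda>p. - F p) A"
    proof (rule sum.reindex_bij_witness[of _ "\<lambda>(i, j). (Suc j, i)" "\<lambda>(i, j). (j, i - 1)"])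
      fix p assume "p \<in> B"
      then obtain i j where p: "p = (i, j)" "i \<le> Suc (Suc k)" "j < i"
        by (auto simp: B_def)
      then obtain l where l: "i = Suc l" "j \<le> l"
        by (cases i) auto
      have "omit_nth l (omit_nth j gs) = omit_nth j (omit_nth (Suc l) gs)"
        using True p l by (intro omit_nth_omit_nth) (auto simp: tuples_def)
      then show "- F (case p of (i, j) \<Rightarrow> (j, i - 1)) = F p"
        using p l by (simp add: F_def add.commute)
    qed (auto simp: A_def B_def)
    then have "sum F ({..Suc (Suc k)} \<times> {..Suc k}) = 0"
      unfolding AB(1) using fin AB(2) by (simp add: sum.union_disjoint sum_negf)
    moreover have "coboundary G (Suc k) (coboundary G k f) gs
        = (\<Sum>i\<le>Suc (Suc k). \<Sum>j\<le>Suc k. F (i, j))"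
      using True omit_nth_tuples[OF True]
      by (simp add: coboundary_def F_def scaleR_sum_right power_add del: sum.atMost_Suc)
    ultimately show ?thesis
      by (simp add: sum.cartesian_product del: sum.atMost_Suc)
  qed (simp add: coboundary_def)
qed

end

theory Submission
  imports Defs "HOL-Probability.Probability"
begin

text \<open>
  For a finite set \<open>B\<close> of group elements the hypothesis yields elements \<open>s\<^sub>0, s\<^sub>1, \<dots>\<close> such that the
  conjugates of \<open>\<langle>B\<rangle>\<close> by the \<open>s\<^sub>i\<close> commute pairwise.  Given a bounded cocycle \<open>f\<close>, let \<open>\<nu>\<close> be the law
  of \<open>s\<^sub>i\<^sup>-\<^sup>1 \<Prod>\<^sub>l s\<^sub>l b\<^sub>l s\<^sub>l\<^sup>-\<^sup>1\<close>, where \<open>l\<close> ranges over the indices below \<open>k\<close> other than \<open>i\<close> and the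
  \<open>b\<^sub>l\<close> are independent and uniform in \<open>B\<close>.  The prism operator shows \<open>f\<close> cohomologous to
  \<open>f\<nu>(g\<^sub>0, \<dots>) = \<E> f(g\<^sub>0 y\<^sub>0, \<dots>)\<close> with \<open>y\<^sub>j\<close> independent of law \<open>\<nu>\<close>, by a primitive bounded independently
  of \<open>k\<close> and \<open>i\<close>.  On tuples from \<open>B\<close>, up to the isometry \<open>s\<^sub>i\<^sup>-\<^sup>1\<close>, \<open>f\<nu>(h)\<close> is the expectation of a function
  on sequences of tuples from \<open>B\<close>, conditioned on the \<open>i\<close>-th entry being \<open>h\<close>.  In the weak-* limit
  \<open>k \<rightarrow> \<infinity>\<close> these conditional expectations form a bounded martingale in a separable dual; its
  increments tend to 0 in mean, so for large \<open>i\<close> the limit of \<open>f\<nu>\<close> is almost constant on \<open>B\<close>, hence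
  almost a coboundary.  A weak-* limit over all finite \<open>B\<close> gives a primitive of \<open>f\<close>.
\<close>

section \<open>Ultrafilters and weak-* limits\<close>

definition ultrafilter :: "'a filter \<Rightarrow> bool"
  where "ultrafilter U \<longleftrightarrow>
    U \<noteq> bot \<and> (\<forall>P. eventually P U \<or> eventually (\<lambda>x. \<not> P x) U)"

text \<open>Zorn's lemma among the proper filters below \<open>F\<close> gives a minimal one. It
  decides every \<open>P\<close>: if its restriction to \<open>P\<close> is proper, minimality makes
  the restriction equal to the filter itself.\<close>

lemma ultrafilter_exists:
  fixes F :: "'a filter"
  assumes "F \<noteq> bot"
  obtains U where "ultrafilter U" "U \<le> F"
proof -
  define A where "A = {U. U \<noteq> bot \<and> U \<le> F}"
  have "\<exists>U\<in>A. \<forall>V\<in>A. U \<ge> V \<longrightarrow> V = U"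
  proof (rule predicate_Zorn[of A "\<lambda>U V. U \<ge> V"])
    show "partial_order_on A (relation_of (\<lambda>U V. U \<ge> V) A)"
      by (auto simp: partial_order_on_def preorder_on_def refl_on_def trans_def antisym_def
          relation_of_def)
    fix C assume "C \<in> Chains (relation_of (\<lambda>U V. U \<ge> V) A)"
    then have CA: "C \<subseteq> A" and chain: "\<And>U V. U \<in> C \<Longrightarrow> V \<in> C \<Longrightarrow> U \<ge> V \<or> V \<ge> U"
      by (auto simp: Chains_def relation_of_def)
    show "\<exists>u\<in>A. \<forall>a\<in>C. a \<ge> u"
    proof (cases "C = {}")
      case True
      then show ?thesis
        using assms by (auto simp: A_def)
    next
      case False
      \<comment> \<open>A chain is directed, so an event holds in \<open>Inf C\<close> only if it
        already holds in one member; hence the infimum of proper filters is proper.\<close>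
      have Inf_iff: "eventually (\<lambda>_. False) (Inf C) \<longleftrightarrow> (\<exists>b\<in>C. eventually (\<lambda>_. False) b)"
      proof (rule eventually_Inf_base[OF False])
        fix U V assume "U \<in> C" "V \<in> C"
        then show "\<exists>x\<in>C. x \<le> inf U V"
          using chain[of U V] by (auto simp: inf_absorb1 inf_absorb2)
      qed
      have "b \<noteq> bot" if "b \<in> C" for b
        using CA that by (auto simp: A_def)
      then have "Inf C \<noteq> bot"
        unfolding trivial_limit_def Inf_iff by simp
      moreover have "Inf C \<le> F"
      proof -
        obtain U where "U \<in> C" "U \<le> F"
          using False CA by (auto simp: A_def)
        then show ?thesis
          by (rule Inf_lower2)
      qed
      ultimately show ?thesis
        by (auto simp: A_def intro: Inf_lower)
    qed
  qed
  then obtain U where U: "U \<noteq> bot" "U \<le> F"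
    and max: "\<And>V. V \<noteq> bot \<Longrightarrow> V \<le> F \<Longrightarrow> V \<le> U \<Longrightarrow> V = U"
    by (auto simp: A_def)
  have "eventually P U" if "\<not> eventually (\<lambda>x. \<not> P x) U" for P
  proof -
    have "inf U (principal {x. P x}) \<noteq> bot"
      using that by (auto simp: trivial_limit_def eventually_inf_principal)
    moreover have "inf U (principal {x. P x}) \<le> F"
      using U(2) by (rule le_infI1)
    ultimately have "inf U (principal {x. P x}) = U"
      by (rule max) simp
    moreover have "eventually P (inf U (principal {x. P x}))"
      by (simp add: eventually_inf_principal)
    ultimately show ?thesis
      by simp
  qed
  then have "ultrafilter U"
    using U(1) by (auto simp: ultrafilter_def)
  then show ?thesis
    using U(2) that by blast
qed

text \<open>Compactness of \<open>{-C..C}\<close> gives a cluster point of the image filter, and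
  every cluster point of an ultrafilter is a limit.\<close>

lemma ultrafilter_bounded_tendsto:
  fixes g :: "'i \<Rightarrow> real"
  assumes U: "ultrafilter U" and bd: "eventually (\<lambda>k. \<bar>g k\<bar> \<le> C) U"
  obtains l where "(g \<longlongrightarrow> l) U"
proof -
  have "eventually (\<lambda>x. x \<in> {-C..C}) (filtermap g U)"
    using bd by (auto simp: eventually_filtermap abs_le_iff elim!: eventually_mono)
  moreover have "filtermap g U \<noteq> bot"
    using U by (simp add: ultrafilter_def filtermap_bot_iff)
  ultimately obtain l where l: "inf (nhds l) (filtermap g U) \<noteq> bot"
    using compact_filter[of "{-C..C}"] compact_Icc by metis
  have "(g \<longlongrightarrow> l) U"
  proof (rule topological_tendstoI)
    fix S assume S: "open S" "l \<in> S"
    show "eventually (\<lambda>k. g k \<in> S) U"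
    proof (rule ccontr)
      assume "\<not> eventually (\<lambda>k. g k \<in> S) U"
      then have "eventually (\<lambda>k. g k \<notin> S) U"
        using U by (auto simp: ultrafilter_def)
      then have "eventually (\<lambda>x. x \<notin> S) (filtermap g U)"
        by (simp add: eventually_filtermap)
      moreover have "eventually (\<lambda>x. x \<in> S) (nhds l)"
        using S by (auto simp: eventually_nhds)
      ultimately have "eventually (\<lambda>x. False) (inf (nhds l) (filtermap g U))"
        by (auto simp: eventually_inf)
      then show False
        using l by (simp add: trivial_limit_def)
    qed
  qed
  then show ?thesis
    by (rule that)
qed

section \<open>Pairings of a dual space with its predual, and weak-* convergence\<close>

text \<open>\<open>D\<close> abstracts the evaluation of a dual space \<open>'e\<close> on its
  predual \<open>'f\<close>: \<open>bound\<close> and \<open>norming\<close> make the norm of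
  \<open>'e\<close> the dual norm, and \<open>representable\<close> makes \<open>'e\<close> the
  whole dual.\<close>

locale dual_pairing =
  fixes D :: "'e::banach \<Rightarrow> 'f::banach \<Rightarrow> real"
  assumes linear_left: "linear (\<lambda>x. D x v)"
    and linear_right: "linear (D x)"
    and bound: "\<bar>D x v\<bar> \<le> norm x * norm v"
    and norming: "0 \<le> C \<Longrightarrow> (\<And>v. \<bar>D x v\<bar> \<le> C * norm v) \<Longrightarrow> norm x \<le> C"
    and representable: "linear \<phi> \<Longrightarrow> (\<And>v. \<bar>\<phi> v\<bar> \<le> C * norm v) \<Longrightarrow> \<exists>x. \<forall>v. D x v = \<phi> v"
begin

text \<open>This is weak-* convergence of \<open>a\<close> to \<open>x\<close> along the filter
  \<open>U\<close>.\<close>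

definition wconv :: "('i \<Rightarrow> 'e) \<Rightarrow> 'e \<Rightarrow> 'i filter \<Rightarrow> bool"
  where "wconv a x U \<longleftrightarrow> (\<forall>v. ((\<lambda>k. D (a k) v) \<longlongrightarrow> D x v) U)"

lemmas D_left_simps =
  linear_add[OF linear_left] linear_diff[OF linear_left] linear_0[OF linear_left]
  linear_scale[OF linear_left] linear_sum[OF linear_left] linear_neg[OF linear_left]

lemma wconv_const: "wconv (\<lambda>k. x) x U"
  by (simp add: wconv_def)

lemma wconv_diff: "wconv a x U \<Longrightarrow> wconv b y U \<Longrightarrow> wconv (\<lambda>k. a k - b k) (x - y) U"
  by (auto simp: wconv_def D_left_simps intro!: tendsto_diff)

lemma wconv_scaleR: "wconv a x U \<Longrightarrow> wconv (\<lambda>k. c *\<^sub>R a k) (c *\<^sub>R x) U"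
  by (auto simp: wconv_def D_left_simps intro!: tendsto_mult)

lemma wconv_sum:
  "(\<And>j. j \<in> J \<Longrightarrow> wconv (a j) (x j) U) \<Longrightarrow> wconv (\<lambda>k. \<Sum>j\<in>J. a j k) (\<Sum>j\<in>J. x j) U"
  by (auto simp: wconv_def D_left_simps intro!: tendsto_sum)

lemma wconv_cong:
  assumes "wconv a x U" "eventually (\<lambda>k. a k = b k) U"
  shows "wconv b x U"
  unfolding wconv_def
proof
  fix v
  have "eventually (\<lambda>k. D (a k) v = D (b k) v) U"
    using assms(2) by (auto elim: eventually_mono)
  then show "((\<lambda>k. D (b k) v) \<longlongrightarrow> D x v) U"
    by (rule tendsto_cong[THEN iffD1]) (use assms(1) in \<open>simp add: wconv_def\<close>)
qed

lemma bound_le: "norm x \<le> C \<Longrightarrow> \<bar>D x v\<bar> \<le> C * norm v"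
  by (rule order_trans[OF bound mult_right_mono]) auto

text \<open>Closed balls are weak-* closed, because the dual norm is a supremum of weak-* continuous
  functions.\<close>

lemma norm_le_wconv:
  assumes U: "U \<noteq> bot" and a: "wconv a x U" and C: "eventually (\<lambda>k. norm (a k) \<le> C) U"
  shows "norm x \<le> C"
proof (rule norming)
  obtain k where "norm (a k) \<le> C"
    using eventually_happens[OF C] U by auto
  then show "0 \<le> C"
    by (rule order_trans[OF norm_ge_zero])
  fix v
  have "((\<lambda>k. \<bar>D (a k) v\<bar>) \<longlongrightarrow> \<bar>D x v\<bar>) U"
    using a by (auto simp: wconv_def intro!: tendsto_rabs)
  moreover have "eventually (\<lambda>k. \<bar>D (a k) v\<bar> \<le> C * norm v) U"
    using C by eventually_elim (rule bound_le)
  ultimately show "\<bar>D x v\<bar> \<le> C * norm v"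
    using U tendsto_upperbound by blast
qed

lemma wconv_unique:
  assumes "U \<noteq> bot" "wconv a x U" "wconv a y U"
  shows "x = y"
  using norm_le_wconv[OF assms(1) wconv_diff[OF assms(2,3)], of 0] by simp

text \<open>Banach-Alaoglu along an ultrafilter: the limits of the pairings with each
  \<open>v\<close> form a bounded linear functional, which is represented by an element of the
  dual.\<close>

lemma wconv_exists:
  assumes U: "ultrafilter U" and C: "eventually (\<lambda>k. norm (a k) \<le> C) U"
  obtains x where "wconv a x U"
proof -
  have ntriv: "U \<noteq> bot"
    using U by (simp add: ultrafilter_def)
  have ev: "eventually (\<lambda>k. \<bar>D (a k) v\<bar> \<le> C * norm v) U" for v
    using C by eventually_elim (rule bound_le)
  then have "\<exists>l. ((\<lambda>k. D (a k) v) \<longlongrightarrow> l) U" for v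
    using ultrafilter_bounded_tendsto[OF U] by metis
  then obtain \<phi> where \<phi>: "\<And>v. ((\<lambda>k. D (a k) v) \<longlongrightarrow> \<phi> v) U"
    by metis
  have "linear \<phi>"
  proof (rule linearI)
    fix v w and r :: real
    have "((\<lambda>k. D (a k) (v + w)) \<longlongrightarrow> \<phi> v + \<phi> w) U"
      by (simp add: linear_add[OF linear_right] tendsto_add \<phi>)
    then show "\<phi> (v + w) = \<phi> v + \<phi> w"
      using \<phi> ntriv tendsto_unique by blast
    have "((\<lambda>k. D (a k) (r *\<^sub>R v)) \<longlongrightarrow> r *\<^sub>R \<phi> v) U"
      unfolding linear_scale[OF linear_right] by (intro tendsto_scaleR tendsto_const \<phi>)
    then show "\<phi> (r *\<^sub>R v) = r *\<^sub>R \<phi> v"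
      using \<phi> ntriv tendsto_unique by blast
  qed
  moreover have "\<bar>\<phi> v\<bar> \<le> C * norm v" for v
    using tendsto_upperbound[OF tendsto_rabs[OF \<phi>] ev ntriv] .
  ultimately obtain x where "\<forall>v. D x v = \<phi> v"
    using representable by blast
  then show ?thesis
    using \<phi> by (intro that[of x]) (simp add: wconv_def)
qed

lemma wconv_exists_bounded:
  assumes "ultrafilter U" "\<And>k. norm (a k) \<le> C"
  shows "\<exists>x. wconv a x U"
proof -
  have "eventually (\<lambda>k. norm (a k) \<le> C) U"
    using assms(2) by simp
  then show ?thesis
    using wconv_exists[OF assms(1)] by blast
qed

end

section \<open>Bounded martingales in a separable dual\<close>

locale uniform_sequences =
  fixes A :: "'a set"
  assumes finite_A: "finite A" and A_nonempty: "A \<noteq> {}"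
begin

definition words :: "nat \<Rightarrow> 'a list set"
  where "words L = {w. set w \<subseteq> A \<and> length w = L}"

definition seqs :: "(nat \<Rightarrow> 'a) measure"
  where "seqs = PiM UNIV (\<lambda>_. uniform_count_measure A)"

definition prefix :: "nat \<Rightarrow> (nat \<Rightarrow> 'a) \<Rightarrow> 'a list"
  where "prefix N \<omega> = map \<omega> [0..<N]"

definition cylinder :: "'a list \<Rightarrow> (nat \<Rightarrow> 'a) set"
  where "cylinder w = {\<omega> \<in> space seqs. prefix (length w) \<omega> = w}"

lemma cylinder_Int_space: "cylinder w \<inter> space seqs = cylinder w"
  by (auto simp: cylinder_def)

lemma prob_space_A: "prob_space (uniform_count_measure A)"
  by (rule prob_space_uniform_count_measure[OF finite_A A_nonempty])

sublocale S: prob_space seqs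
  unfolding seqs_def by (rule prob_space_PiM) (rule prob_space_A)

lemma space_seqs: "space seqs = {\<omega>. \<forall>i. \<omega> i \<in> A}"
  by (auto simp: seqs_def space_PiM space_uniform_count_measure PiE_def Pi_def extensional_def)

lemma finite_words: "finite (words L)"
  unfolding words_def by (rule finite_lists_length_eq[OF finite_A])

lemma card_A_pos: "0 < card A"
  using finite_A A_nonempty by (simp add: card_gt_0_iff)

lemma length_prefix [simp]: "length (prefix N \<omega>) = N"
  by (simp add: prefix_def)

lemma prefix_in_words: "\<omega> \<in> space seqs \<Longrightarrow> prefix N \<omega> \<in> words N"
  by (auto simp: prefix_def words_def space_seqs)

lemma take_prefix: "N \<le> L \<Longrightarrow> take N (prefix L \<omega>) = prefix N \<omega>"
  by (simp add: prefix_def take_map min_def)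

lemma prefix_Suc: "prefix (Suc N) \<omega> = prefix N \<omega> @ [\<omega> N]"
  by (simp add: prefix_def)

text \<open>This choice of generators is the one on which \<open>cylinder_approximation\<close>
  performs its induction.\<close>

lemma sets_seqs: "sets seqs = sigma_sets (space seqs) {{\<omega> \<in> space seqs. \<omega> i \<in> B} | i B. B \<subseteq> A}"
proof -
  have "space seqs = (\<Pi>\<^sub>E i\<in>UNIV. space (uniform_count_measure A))"
    by (simp add: seqs_def space_PiM)
  then show ?thesis
    unfolding seqs_def sets_PiM_single by (simp add: sets_uniform_count_measure)
qed

lemma cylinder_eq_emb:
  assumes "w \<in> words L"
  shows "cylinder w = prod_emb UNIV (\<lambda>_. uniform_count_measure A) {..<L} (\<Pi>\<^sub>E i\<in>{..<L}. {w ! i})"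
proof -
  have "prefix L \<omega> = w \<longleftrightarrow> (\<forall>i<L. \<omega> i = w ! i)" for \<omega>
    using assms by (auto simp: prefix_def list_eq_iff_nth_eq words_def)
  then show ?thesis
    using assms
    by (auto simp: cylinder_def prod_emb_def space_seqs PiE_def Pi_def extensional_def
        space_uniform_count_measure words_def restrict_def)
qed

lemma sets_cylinder:
  assumes "w \<in> words L"
  shows "cylinder w \<in> sets seqs"
  unfolding cylinder_eq_emb[OF assms] seqs_def
proof (intro sets_PiM_I)
  show "\<forall>i\<in>{..<L}. {w ! i} \<in> sets (uniform_count_measure A)"
    using assms nth_mem by (fastforce simp: words_def sets_uniform_count_measure)
qed auto

lemma measure_cylinder:
  assumes "w \<in> words L"
  shows "S.prob (cylinder w) = 1 / real (card A) ^ L"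
proof -
  interpret product_prob_space "\<lambda>_. uniform_count_measure A" "UNIV :: nat set"
    by (rule product_prob_spaceI) (rule prob_space_A)
  have mem: "w ! i \<in> A" if "i < L" for i
    using that assms nth_mem by (fastforce simp: words_def)
  have "emeasure seqs (cylinder w) = (\<Prod>i<L. emeasure (uniform_count_measure A) {w ! i})"
    unfolding cylinder_eq_emb[OF assms] seqs_def
    by (rule emeasure_PiM_emb) (auto simp: mem sets_uniform_count_measure)
  also have "\<dots> = (\<Prod>i<L. ennreal (1 / real (card A)))"
    by (rule prod.cong) (simp_all add: mem emeasure_uniform_count_measure finite_A)
  also have "\<dots> = ennreal (1 / real (card A) ^ L)"
    by (simp add: ennreal_power power_one_over)
  finally show ?thesis
    by (simp add: measure_def)
qed

lemma prefix_event_eq: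
  "{\<omega> \<in> space seqs. Q (prefix N \<omega>)} = (\<Union>w\<in>{w \<in> words N. Q w}. cylinder w)"
  using prefix_in_words by (auto simp: cylinder_def words_def)

lemma sets_prefix_event: "{\<omega> \<in> space seqs. Q (prefix N \<omega>)} \<in> sets seqs"
  unfolding prefix_event_eq by (rule sets.finite_UN) (auto simp: finite_words sets_cylinder)

text \<open>The cylinders of the words of one fixed length partition the space.\<close>

lemma sum_prob_cylinder_Int:
  assumes "Y \<in> sets seqs"
  shows "(\<Sum>w\<in>words L. S.prob (cylinder w \<inter> Y)) = S.prob Y"
proof -
  have "Y = (\<Union>w\<in>words L. cylinder w \<inter> Y)"
    using sets.sets_into_space[OF assms] prefix_in_words
    by (fastforce simp: cylinder_def words_def)
  then have "S.prob Y = S.prob (\<Union>w\<in>words L. cylinder w \<inter> Y)"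
    by simp
  also have "\<dots> = (\<Sum>w\<in>words L. S.prob (cylinder w \<inter> Y))"
  proof (rule S.finite_measure_finite_Union[OF finite_words])
    show "(\<lambda>w. cylinder w \<inter> Y) ` words L \<subseteq> sets seqs"
      using assms sets_cylinder by auto
    show "disjoint_family_on (\<lambda>w. cylinder w \<inter> Y) (words L)"
      by (auto simp: disjoint_family_on_def cylinder_def words_def)
  qed
  finally show ?thesis ..
qed

lemma cylinder_children:
  assumes "w \<in> words L"
  shows "cylinder w = (\<Union>a\<in>A. cylinder (w @ [a]))"
  by (auto simp: cylinder_def prefix_Suc space_seqs)

lemma words_snoc: "w @ [a] \<in> words (Suc L) \<longleftrightarrow> w \<in> words L \<and> a \<in> A"
  by (auto simp: words_def)

lemma prob_cylinder_children:
  assumes "w \<in> words L" "Y \<in> sets seqs"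
  shows "S.prob (cylinder w \<inter> Y) = (\<Sum>a\<in>A. S.prob (cylinder (w @ [a]) \<inter> Y))"
proof -
  have "S.prob (cylinder w \<inter> Y) = S.prob (\<Union>a\<in>A. cylinder (w @ [a]) \<inter> Y)"
    unfolding cylinder_children[OF assms(1)] by simp
  also have "\<dots> = (\<Sum>a\<in>A. S.prob (cylinder (w @ [a]) \<inter> Y))"
  proof (rule S.finite_measure_finite_Union[OF finite_A])
    show "(\<lambda>a. cylinder (w @ [a]) \<inter> Y) ` A \<subseteq> sets seqs"
      using assms sets_cylinder[of "w @ [_]" "Suc L"] by (auto simp: words_snoc)
    show "disjoint_family_on (\<lambda>a. cylinder (w @ [a]) \<inter> Y) A"
      by (auto simp: disjoint_family_on_def cylinder_def)
  qed
  finally show ?thesis .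
qed

lemma words_Suc_snoc: "words (Suc L) = (\<lambda>(w, a). w @ [a]) ` (words L \<times> A)"
proof
  show "words (Suc L) \<subseteq> (\<lambda>(w, a). w @ [a]) ` (words L \<times> A)"
  proof
    fix v assume v: "v \<in> words (Suc L)"
    then obtain w a where "v = w @ [a]"
      by (auto simp: words_def length_Suc_conv_rev)
    then show "v \<in> (\<lambda>(w, a). w @ [a]) ` (words L \<times> A)"
      using v by (auto simp: words_snoc)
  qed
qed (auto simp: words_snoc)

lemma sum_words_Suc_snoc: "(\<Sum>v\<in>words (Suc L). g v) = (\<Sum>w\<in>words L. \<Sum>a\<in>A. g (w @ [a]))"
  unfolding words_Suc_snoc sum.cartesian_product
  by (subst sum.reindex) (auto simp: inj_on_def case_prod_beta)


section \<open>Stopping bounds for scalar martingales\<close>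

text \<open>Optional stopping at the first time at which the martingale \<open>x\<close> becomes small.\<close>

lemma stopped_martingale_bound:
  fixes x :: "'a list \<Rightarrow> real"
  assumes mart: "\<And>L w. w \<in> words L \<Longrightarrow> real (card A) * x w = (\<Sum>a\<in>A. x (w @ [a]))"
    and bound: "\<And>L w. w \<in> words L \<Longrightarrow> \<bar>x w\<bar> \<le> C"
    and \<epsilon>: "0 \<le> \<epsilon>" and w: "w \<in> words L" and LK: "L \<le> K"
  shows "\<bar>x w\<bar> * S.prob (cylinder w) \<le> \<epsilon> * S.prob (cylinder w)
    + C * S.prob (cylinder w \<inter> {\<omega> \<in> space seqs. \<forall>N. L \<le> N \<and> N \<le> K \<longrightarrow> \<epsilon> < \<bar>x (prefix N \<omega>)\<bar>})"
    (is "?lhs w \<le> ?rhs L w")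
  using w LK
\<comment> \<open>Backward induction in time: if \<open>x w\<close> is small the bound is immediate,
  otherwise \<open>x w\<close> is the average of its values at the children and their bounds are
  added up.\<close>
proof (induction "K - L" arbitrary: w L)
  case (0 L w)
  then have L: "L = K"
    by simp
  show ?case
  proof (cases "\<bar>x w\<bar> \<le> \<epsilon>")
    case True
    have "0 \<le> C"
      using bound[OF 0(2)] by linarith
    then show ?thesis
      by (intro order_trans[OF mult_right_mono[OF True]]) auto
  next
    case False
    then have eq: "cylinder w \<inter> {\<omega> \<in> space seqs. \<forall>N. L \<le> N \<and> N \<le> K \<longrightarrow> \<epsilon> < \<bar>x (prefix N \<omega>)\<bar>} = cylinder w"
      using 0(2) by (auto simp: cylinder_def L words_def)
    have "?lhs w \<le> C * S.prob (cylinder w)"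
      using bound[OF 0(2)] by (intro mult_right_mono) auto
    then show ?thesis
      unfolding eq using \<epsilon> by (simp add: add_increasing)
  qed
next
  case (Suc r L w)
  show ?case
  proof (cases "\<bar>x w\<bar> \<le> \<epsilon>")
    case True
    have "0 \<le> C"
      using bound[OF Suc(3)] by linarith
    then show ?thesis
      by (intro order_trans[OF mult_right_mono[OF True]]) auto
  next
    case False
    define Z where "Z L = {\<omega> \<in> space seqs. \<forall>N. L \<le> N \<and> N \<le> K \<longrightarrow> \<epsilon> < \<bar>x (prefix N \<omega>)\<bar>}" for L
    have Z: "Z M \<in> sets seqs" for M
    proof -
      have "Z M = {\<omega> \<in> space seqs. (\<lambda>u. \<forall>N. M \<le> N \<and> N \<le> K \<longrightarrow> \<epsilon> < \<bar>x (take N u)\<bar>) (prefix K \<omega>)}"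
        by (auto simp: Z_def take_prefix)
      then show ?thesis
        using sets_prefix_event by simp
    qed
    \<comment> \<open>In this case the requirement at time \<open>L\<close> holds on the whole
      cylinder of \<open>w\<close>, so starting at \<open>L\<close> or at \<open>Suc L\<close> gives
      the same event.\<close>
    have eq: "cylinder (w @ [a]) \<inter> Z (Suc L) = cylinder (w @ [a]) \<inter> Z L" for a
    proof -
      have "\<epsilon> < \<bar>x (prefix L \<omega>)\<bar>" if "\<omega> \<in> cylinder (w @ [a])" for \<omega>
      proof -
        have "prefix L \<omega> = w"
          using that Suc(3) by (auto simp: cylinder_def words_def prefix_Suc)
        then show ?thesis
          using False by simp
      qed
      then show ?thesis
        by (auto simp: Z_def) (metis le_antisym not_less_eq_eq)
    qed
    have pa: "S.prob (cylinder (w @ [a])) = S.prob (cylinder w) / card A" if "a \<in> A" for a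
      using that Suc(3) by (simp add: measure_cylinder words_snoc[THEN iffD2] measure_cylinder[of "w @ [a]" "Suc L"])
    have "?lhs w = \<bar>\<Sum>a\<in>A. x (w @ [a])\<bar> * (S.prob (cylinder w) / card A)"
      using card_A_pos by (simp add: mart[OF Suc(3), symmetric] abs_mult)
    also have "\<dots> \<le> (\<Sum>a\<in>A. \<bar>x (w @ [a])\<bar>) * (S.prob (cylinder w) / card A)"
      by (intro mult_right_mono sum_abs) auto
    also have "\<dots> = (\<Sum>a\<in>A. ?lhs (w @ [a]))"
      by (simp add: sum_distrib_right sum_divide_distrib pa)
    also have "\<dots> \<le> (\<Sum>a\<in>A. ?rhs (Suc L) (w @ [a]))"
      using Suc by (intro sum_mono Suc(1)) (auto simp: words_snoc)
    also have "\<dots> = \<epsilon> * (\<Sum>a\<in>A. S.prob (cylinder (w @ [a]) \<inter> space seqs))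
        + C * (\<Sum>a\<in>A. S.prob (cylinder (w @ [a]) \<inter> Z L))"
      unfolding Z_def[symmetric] eq by (simp add: cylinder_Int_space sum.distrib sum_distrib_left)
    also have "\<dots> = ?rhs L w"
      using prob_cylinder_children[OF Suc(3) sets.top] prob_cylinder_children[OF Suc(3) Z]
      unfolding Z_def[symmetric] by (simp add: cylinder_Int_space)
    finally show ?thesis .
  qed
qed

text \<open>Let \<open>K\<close> tend to infinity in the stopped bound: a path in \<open>Y\<close>
  becomes small again after any time, so the events of staying large up to \<open>K\<close> decrease
  to a set disjoint from \<open>Y\<close>.\<close>

lemma recurrent_martingale_bound:
  fixes x :: "'a list \<Rightarrow> real"
  assumes mart: "\<And>L w. w \<in> words L \<Longrightarrow> real (card A) * x w = (\<Sum>a\<in>A. x (w @ [a]))"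
    and bound: "\<And>L w. w \<in> words L \<Longrightarrow> \<bar>x w\<bar> \<le> C"
    and \<epsilon>: "0 \<le> \<epsilon>" and w: "w \<in> words L"
    and Y: "Y \<in> sets seqs" "\<And>\<omega> K. \<omega> \<in> Y \<Longrightarrow> \<exists>N\<ge>K. \<bar>x (prefix N \<omega>)\<bar> \<le> \<epsilon>"
  shows "\<bar>x w\<bar> * S.prob (cylinder w) \<le> \<epsilon> * S.prob (cylinder w) + C * S.prob (cylinder w - Y)"
proof -
  define Z where "Z K = {\<omega> \<in> space seqs. \<forall>N. L \<le> N \<and> N \<le> K \<longrightarrow> \<epsilon> < \<bar>x (prefix N \<omega>)\<bar>}" for K
  have Z: "Z K \<in> sets seqs" for K
  proof -
    have "Z K = {\<omega> \<in> space seqs. (\<lambda>u. \<forall>N. L \<le> N \<and> N \<le> K \<longrightarrow> \<epsilon> < \<bar>x (take N u)\<bar>) (prefix K \<omega>)}"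
      by (auto simp: Z_def take_prefix)
    then show ?thesis
      using sets_prefix_event by simp
  qed
  have "0 \<le> C"
    using bound[OF w] by linarith
  have lim: "(\<lambda>K. S.prob (cylinder w \<inter> Z K)) \<longlonglongrightarrow> S.prob (\<Inter>K. cylinder w \<inter> Z K)"
    by (rule S.finite_Lim_measure_decseq) (auto simp: decseq_def Z_def sets_cylinder[OF w] intro!: sets.Int Z[unfolded Z_def])
  have "(\<Inter>K. cylinder w \<inter> Z K) \<subseteq> cylinder w - Y"
  proof
    fix \<omega> assume \<omega>: "\<omega> \<in> (\<Inter>K. cylinder w \<inter> Z K)"
    have "\<omega> \<notin> Y"
    proof
      assume "\<omega> \<in> Y"
      then obtain N where N: "N \<ge> L" "\<bar>x (prefix N \<omega>)\<bar> \<le> \<epsilon>"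
        using Y(2) by blast
      have "\<omega> \<in> Z N"
        using \<omega> by blast
      then show False
        using N by (auto simp: Z_def)
    qed
    then show "\<omega> \<in> cylinder w - Y"
      using \<omega> by blast
  qed
  then have "S.prob (\<Inter>K. cylinder w \<inter> Z K) \<le> S.prob (cylinder w - Y)"
    by (rule S.finite_measure_mono) (use sets_cylinder[OF w] Y(1) in auto)
  moreover have "\<bar>x w\<bar> * S.prob (cylinder w) \<le> \<epsilon> * S.prob (cylinder w) + C * S.prob (\<Inter>K. cylinder w \<inter> Z K)"
  proof (rule LIMSEQ_le_const)
    show "(\<lambda>K. \<epsilon> * S.prob (cylinder w) + C * S.prob (cylinder w \<inter> Z K))
        \<longlonglongrightarrow> \<epsilon> * S.prob (cylinder w) + C * S.prob (\<Inter>K. cylinder w \<inter> Z K)"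
      by (intro tendsto_intros lim)
    show "\<exists>M. \<forall>K\<ge>M. \<bar>x w\<bar> * S.prob (cylinder w)
        \<le> \<epsilon> * S.prob (cylinder w) + C * S.prob (cylinder w \<inter> Z K)"
      using stopped_martingale_bound[OF mart bound \<epsilon> w] by (auto simp: Z_def intro!: exI[of _ L])
  qed
  ultimately show ?thesis
    using \<open>0 \<le> C\<close> by (meson add_left_mono mult_left_mono order_trans)
qed

section \<open>Approximation of events by cylinder events\<close>

text \<open>The probability of the symmetric difference between \<open>Y\<close> and the event that
  the prefix of length \<open>N\<close> satisfies \<open>W\<close>.\<close>

definition approx_error :: "(nat \<Rightarrow> 'a) set \<Rightarrow> nat \<Rightarrow> ('a list \<Rightarrow> bool) \<Rightarrow> real"
  where "approx_error Y N W = S.prob {\<omega> \<in> space seqs. \<omega> \<in> Y \<longleftrightarrow> \<not> W (prefix N \<omega>)}"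

text \<open>Events that can be approximated to every accuracy by conditions on a finite prefix
  contain the generators and are closed under complements and countable unions; a countable union is
  first cut to a finite one.\<close>

lemma cylinder_approximation:
  assumes "Y \<in> sets seqs" "0 < \<eta>"
  shows "\<exists>N W. approx_error Y N W \<le> \<eta>"
  using assms(2)
proof (induction arbitrary: \<eta> rule: sigma_sets.induct[OF assms(1)[unfolded sets_seqs], consumes 0])
  case (1 Y)
  then obtain i B where Y: "Y = {\<omega> \<in> space seqs. \<omega> i \<in> B}"
    by auto
  have eq: "{\<omega> \<in> space seqs. \<omega> \<in> Y \<longleftrightarrow> \<not> prefix (Suc i) \<omega> ! i \<in> B} = {}"
    by (auto simp: Y prefix_def nth_append)
  show ?case
    by (rule exI[of _ "Suc i"], rule exI[of _ "\<lambda>u. u ! i \<in> B"]) (use 1(2) in \<open>simp only: approx_error_def eq measure_empty less_imp_le\<close>)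
next
  case 2
  have "{\<omega> \<in> space seqs. \<omega> \<in> {} \<longleftrightarrow> \<not> (\<lambda>u. False) (prefix 0 \<omega>)} = {}"
    by auto
  then show ?case
    using 2(1) by (intro exI[of _ 0] exI[of _ "\<lambda>u. False"]) (simp add: approx_error_def)
next
  case (3 Y)
  then obtain N W where NW: "approx_error Y N W \<le> \<eta>"
    by blast
  have eq: "{\<omega> \<in> space seqs. \<omega> \<in> space seqs - Y \<longleftrightarrow> \<not> \<not> W (prefix N \<omega>)}
      = {\<omega> \<in> space seqs. \<omega> \<in> Y \<longleftrightarrow> \<not> W (prefix N \<omega>)}"
    by auto
  show ?case
    by (rule exI[of _ N], rule exI[of _ "\<lambda>u. \<not> W u"]) (use NW in \<open>simp only: approx_error_def eq\<close>)
next
  case (4 Y)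
  have Y: "Y i \<in> sets seqs" for i
    using 4(1) by (simp add: sets_seqs)
  have "(\<lambda>n. S.prob (\<Union>i<n. Y i)) \<longlonglongrightarrow> S.prob (\<Union>n. \<Union>i<n. Y i)"
  proof (rule S.finite_Lim_measure_incseq)
    show "incseq (\<lambda>n. \<Union>i<n. Y i)"
      by (intro monoI UN_mono) auto
  qed (use Y in auto)
  moreover have "(\<Union>n. \<Union>i<n. Y i) = (\<Union>i. Y i)"
    by auto
  ultimately have "eventually (\<lambda>n. S.prob (\<Union>i. Y i) - \<eta> / 2 < S.prob (\<Union>i<n. Y i)) sequentially"
    using 4(3) order_tendstoD(1) by fastforce
  then obtain n where n: "S.prob (\<Union>i. Y i) - \<eta> / 2 < S.prob (\<Union>i<n. Y i)"
    by (auto simp: eventually_sequentially)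
  \<comment> \<open>The \<open>n\<close> errors add up to at most \<open>\<eta> / 2\<close>; the
    summand 1 avoids division by zero for \<open>n = 0\<close>.\<close>
  have "\<exists>N W. approx_error (Y i) N W \<le> \<eta> / (2 * (real n + 1))" for i
    using 4(2) 4(3) by simp
  then obtain N W where NW: "\<And>i. approx_error (Y i) (N i) (W i) \<le> \<eta> / (2 * (real n + 1))"
    by metis
  define K where "K = (\<Sum>i<n. N i)"
  have NK: "N i \<le> K" if "i < n" for i
    unfolding K_def using that by (intro member_le_sum) auto
  define V where "V u \<longleftrightarrow> (\<exists>i<n. W i (take (N i) u))" for u
  let ?E = "\<lambda>i. {\<omega> \<in> space seqs. \<omega> \<in> Y i \<longleftrightarrow> \<not> W i (prefix (N i) \<omega>)}"
  have E: "?E i \<in> sets seqs" for i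
  proof -
    have eq: "?E i = (Y i - {\<omega> \<in> space seqs. W i (prefix (N i) \<omega>)}) \<union> ({\<omega> \<in> space seqs. W i (prefix (N i) \<omega>)} - Y i)"
      using sets.sets_into_space[OF Y[of i]] by auto
    show ?thesis
      unfolding eq by (intro sets.Un sets.Diff Y sets_prefix_event)
  qed
  have "{\<omega> \<in> space seqs. \<omega> \<in> (\<Union>i. Y i) \<longleftrightarrow> \<not> V (prefix K \<omega>)}
      \<subseteq> ((\<Union>i. Y i) - (\<Union>i<n. Y i)) \<union> (\<Union>i<n. ?E i)"
    by (auto simp: V_def take_prefix NK)
  then have "S.prob {\<omega> \<in> space seqs. \<omega> \<in> (\<Union>i. Y i) \<longleftrightarrow> \<not> V (prefix K \<omega>)}
      \<le> S.prob (((\<Union>i. Y i) - (\<Union>i<n. Y i)) \<union> (\<Union>i<n. ?E i))"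
    by (rule S.finite_measure_mono) (use Y E in auto)
  also have "\<dots> \<le> S.prob ((\<Union>i. Y i) - (\<Union>i<n. Y i)) + S.prob (\<Union>i<n. ?E i)"
    by (rule measure_Un_le) (use Y E in auto)
  also have "\<dots> \<le> \<eta> / 2 + \<eta> / 2"
  proof (rule add_mono)
    show "S.prob ((\<Union>i. Y i) - (\<Union>i<n. Y i)) \<le> \<eta> / 2"
      using n Y by (subst S.finite_measure_Diff) auto
    have "S.prob (\<Union>i<n. ?E i) \<le> (\<Sum>i<n. S.prob (?E i))"
      by (rule S.finite_measure_subadditive_finite) (use E in auto)
    also have "\<dots> \<le> (\<Sum>i<n. \<eta> / (2 * (real n + 1)))"
      by (rule sum_mono) (rule NW[unfolded approx_error_def])
    also have "\<dots> \<le> \<eta> / 2"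
      using 4(3) by (simp add: field_simps)
    finally show "S.prob (\<Union>i<n. ?E i) \<le> \<eta> / 2" .
  qed
  finally show ?case
    by (intro exI[of _ K] exI[of _ V]) (simp add: approx_error_def)
qed

end

section \<open>Martingales with values in a separable dual\<close>

text \<open>\<open>M w\<close> is the value of the martingale on the cylinder of \<open>w\<close>.
  Separability enters as a sequence \<open>e\<close> that is dense in norm.\<close>

locale dual_martingale = uniform_sequences A + dual_pairing D
  for A :: "'a set" and D :: "'e::banach \<Rightarrow> 'f::banach \<Rightarrow> real" +
  fixes M :: "'a list \<Rightarrow> 'e" and e :: "nat \<Rightarrow> 'e" and C :: real
  assumes dense: "0 < r \<Longrightarrow> \<exists>m. norm (x - e m) < r"
    and mart: "w \<in> words L \<Longrightarrow> real (card A) *\<^sub>R M w = (\<Sum>a\<in>A. M (w @ [a]))"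
    and M_bound: "w \<in> words L \<Longrightarrow> norm (M w) \<le> C"
begin

text \<open>Were every vector of the unit ball to miss the bound, rescaling would give
  \<open>norm x - r\<close> as a bound for the functional of \<open>x\<close>, against
  \<open>norming\<close>.\<close>

lemma norming_vector:
  assumes "0 < r"
  shows "\<exists>v. norm v \<le> 1 \<and> norm x - r \<le> \<bar>D x v\<bar>"
proof (rule ccontr)
  assume contr: "\<nexists>v. norm v \<le> 1 \<and> norm x - r \<le> \<bar>D x v\<bar>"
  have less: "\<bar>D x v\<bar> < norm x - r" if "norm v \<le> 1" for v
    using contr that by (meson not_le)
  have "norm x \<le> norm x - r"
  proof (rule norming)
    show "0 \<le> norm x - r"
      using less[of 0] by simp
    fix v
    show "\<bar>D x v\<bar> \<le> (norm x - r) * norm v"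
    proof (cases "v = 0")
      case True
      then show ?thesis
        by (simp add: linear_0[OF linear_right])
    next
      case False
      have "D x (inverse (norm v) *\<^sub>R v) = inverse (norm v) * D x v"
        by (simp add: linear_scale[OF linear_right])
      then have "inverse (norm v) * \<bar>D x v\<bar> < norm x - r"
        using less[of "inverse (norm v) *\<^sub>R v"] False by (simp add: abs_mult)
      then show ?thesis
        using False by (simp add: field_simps)
    qed
  qed
  then show False
    using assms by simp
qed

lemma C_nonneg: "0 \<le> C"
  using order_trans[OF norm_ge_zero M_bound[of "[]" 0]] by (simp add: words_def)

text \<open>Along each path \<open>M\<close> has a weak-* cluster point, which lies within
  \<open>\<epsilon>\<close> of some \<open>E m\<close>. Scalar martingales obtained by testing
  \<open>M - E m\<close> are then small infinitely often, and stopping bounds the norm of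
  \<open>M w - E m\<close>, up to the part of the cylinder outside \<open>U m\<close>. Finitely many
  \<open>U m\<close> cover almost everything and are nearly determined by a common prefix, from
  which \<open>Z\<close> reads off \<open>m\<close>.\<close>

lemma averages_close_to_simple:
  assumes "0 < r"
  shows "\<exists>N Z. \<forall>L\<ge>N. (\<Sum>w\<in>words L. norm (M w - Z (take N w))) \<le> r * real (card A) ^ L"
proof -
  \<comment> \<open>The bound 1 keeps the elements \<open>e m\<close> that are needed below norm
    \<open>C + 1\<close>; \<open>r / 4\<close> makes \<open>2 * \<epsilon>\<close> half of the
    allowed error.\<close>
  define \<epsilon> where "\<epsilon> = min 1 (r / 4)"
  have \<epsilon>: "0 < \<epsilon>" "\<epsilon> \<le> 1" "2 * \<epsilon> \<le> r / 2"
    using assms by (auto simp: \<epsilon>_def)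
  \<comment> \<open>Discarding the large elements of the dense sequence makes
    \<open>M w - E m\<close> bounded by \<open>K\<close> uniformly in \<open>m\<close>.\<close>
  define E where "E m = (if norm (e m) \<le> C + 1 then e m else 0)" for m
  have E_bound: "norm (E m) \<le> C + 1" for m
    using C_nonneg by (simp add: E_def)
  define K where "K = 2 * C + 1"
  have ME_bound: "norm (M w - E m) \<le> K" if "w \<in> words L" for w L m
    using norm_triangle_ineq4[of "M w" "E m"] M_bound[OF that] E_bound[of m] by (simp add: K_def)
  have "0 < K"
    using C_nonneg by (simp add: K_def)
  have "\<forall>w m. \<exists>v. norm v \<le> 1 \<and> norm (M w - E m) - \<epsilon> \<le> \<bar>D (M w - E m) v\<bar>"
    using norming_vector[OF \<epsilon>(1)] by metis
  then obtain v where v: "\<And>w m. norm (v w m) \<le> 1" "\<And>w m. norm (M w - E m) - \<epsilon> \<le> \<bar>D (M w - E m) (v w m)\<bar>"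
    by metis
  \<comment> \<open>The estimate at a word uses the test vector chosen for that word, so
    \<open>U\<close> asks for recurrence under the vectors of all words; there are countably many,
    which keeps \<open>U m\<close> measurable.\<close>
  define W where "W = (\<Union>L. words L)"
  have W: "countable W"
    unfolding W_def by (intro countable_UN) (auto intro: countable_finite finite_words)
  \<comment> \<open>Weak-* compactness along each path shows that the \<open>U m\<close> cover everything, so that no almost
    sure convergence of the scalar martingales is needed.\<close>
  define U where "U m = {\<omega> \<in> space seqs. \<forall>u\<in>W. \<forall>K. \<exists>N\<ge>K. \<bar>D (M (prefix N \<omega>) - E m) (v u m)\<bar> \<le> \<epsilon>}" for m
  have U_sets: "U m \<in> sets seqs" for m
  proof -
    have nil: "[] \<in> W"
      by (auto simp: W_def words_def)
    have W0: "W \<noteq> {}"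
      using nil by auto
    define Y where "Y u N = {\<omega> \<in> space seqs. \<bar>D (M (prefix N \<omega>) - E m) (v u m)\<bar> \<le> \<epsilon>}" for u N
    have Y: "Y u N \<in> sets seqs" for u N
      unfolding Y_def by (rule sets_prefix_event)
    have *: "(\<Inter>K. \<Union>N\<in>{K..}. Y u N) \<in> sets seqs" for u
    proof (rule sets.countable_INT')
      show "range (\<lambda>K. \<Union>N\<in>{K..}. Y u N) \<subseteq> sets seqs"
        using Y by (intro image_subsetI sets.countable_UN') auto
    qed auto
    have "U m = (\<Inter>u\<in>W. \<Inter>K. \<Union>N\<in>{K..}. Y u N)"
      using nil by (simp add: U_def Y_def set_eq_iff Bex_def) blast
    also have "\<dots> \<in> sets seqs"
      by (rule sets.countable_INT'[OF W W0]) (use * in blast)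
    finally show ?thesis .
  qed
  have U_cover: "(\<Union>m. U m) = space seqs"
  proof (intro equalityI subsetI)
    fix \<omega> assume \<omega>: "\<omega> \<in> space seqs"
    obtain F :: "nat filter" where F: "ultrafilter F" "F \<le> sequentially"
      using ultrafilter_exists[of sequentially] by auto
    then have F0: "F \<noteq> bot"
      by (simp add: ultrafilter_def)
    have Mb: "norm (M (prefix N \<omega>)) \<le> C" for N
      using M_bound prefix_in_words[OF \<omega>] by blast
    then obtain x where x: "wconv (\<lambda>N. M (prefix N \<omega>)) x F"
      using wconv_exists[OF F(1), of "\<lambda>N. M (prefix N \<omega>)" C] by auto
    have xC: "norm x \<le> C"
      using norm_le_wconv[OF F0 x] Mb by simp
    obtain m where m: "norm (x - e m) < \<epsilon>"
      using dense[OF \<epsilon>(1)] by blast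
    have "norm (e m) \<le> C + 1"
      using norm_triangle_ineq2[of "e m" x] m xC \<epsilon>(2) by (simp add: norm_minus_commute)
    then have mE: "norm (x - E m) < \<epsilon>"
      using m by (simp add: E_def)
    have "\<exists>N\<ge>K. \<bar>D (M (prefix N \<omega>) - E m) (v u m)\<bar> \<le> \<epsilon>" for u K
    proof -
      have "\<bar>D (x - E m) (v u m)\<bar> \<le> norm (x - E m) * norm (v u m)"
        by (rule bound)
      also have "\<dots> \<le> norm (x - E m) * 1"
        using v(1) by (intro mult_left_mono) auto
      finally have "\<bar>D (x - E m) (v u m)\<bar> < \<epsilon>"
        using mE by simp
      moreover have "((\<lambda>N. \<bar>D (M (prefix N \<omega>) - E m) (v u m)\<bar>) \<longlongrightarrow> \<bar>D (x - E m) (v u m)\<bar>) F"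
        using wconv_diff[OF x wconv_const] by (auto simp: wconv_def intro: tendsto_rabs)
      ultimately have "eventually (\<lambda>N. \<bar>D (M (prefix N \<omega>) - E m) (v u m)\<bar> < \<epsilon>) F"
        by (simp add: order_tendstoD(2))
      moreover have "eventually (\<lambda>N. K \<le> N) F"
        using F(2) eventually_ge_at_top filter_leD by blast
      ultimately have "eventually (\<lambda>N. K \<le> N \<and> \<bar>D (M (prefix N \<omega>) - E m) (v u m)\<bar> < \<epsilon>) F"
        by eventually_elim auto
      then show ?thesis
        using eventually_happens F0 by fastforce
    qed
    then show "\<omega> \<in> (\<Union>m. U m)"
      using \<omega> by (auto simp: U_def)
  qed (auto simp: U_def)
  \<comment> \<open>The stopping bound is applied to the scalar martingale tested by the vector
    \<open>v w m\<close>; one \<open>\<epsilon>\<close> comes from stopping, the other from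
    \<open>v w m\<close> being only almost norming.\<close>
  have node: "norm (M w - E m) * S.prob (cylinder w) \<le> 2 * \<epsilon> * S.prob (cylinder w) + K * S.prob (cylinder w - U m)"
    if w: "w \<in> words L" for w L m
  proof -
    have "\<bar>D (M w - E m) (v w m)\<bar> * S.prob (cylinder w) \<le> \<epsilon> * S.prob (cylinder w) + K * S.prob (cylinder w - U m)"
    proof (rule recurrent_martingale_bound[OF _ _ _ w U_sets, where x = "\<lambda>u. D (M u - E m) (v w m)"])
      fix L' u assume u: "u \<in> words L'"
      have "real (card A) *\<^sub>R (M u - E m) = (\<Sum>a\<in>A. M (u @ [a]) - E m)"
        by (simp add: mart[OF u] scaleR_diff_right sum_subtractf scaleR_conv_of_real sum_constant_scaleR)
      then show "real (card A) * D (M u - E m) (v w m) = (\<Sum>a\<in>A. D (M (u @ [a]) - E m) (v w m))"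
        by (metis D_left_simps(4,5) real_scaleR_def)
      have "\<bar>D (M u - E m) (v w m)\<bar> \<le> K * norm (v w m)"
        by (rule bound_le[OF ME_bound[OF u]])
      also have "\<dots> \<le> K * 1"
        using v(1) \<open>0 < K\<close> by (intro mult_left_mono) auto
      finally show "\<bar>D (M u - E m) (v w m)\<bar> \<le> K"
        by simp
    next
      fix \<omega> K assume "\<omega> \<in> U m"
      then show "\<exists>N\<ge>K. \<bar>D (M (prefix N \<omega>) - E m) (v w m)\<bar> \<le> \<epsilon>"
        using w by (auto simp: U_def W_def)
    qed (use \<epsilon> in auto)
    moreover have "norm (M w - E m) * S.prob (cylinder w) \<le> (\<bar>D (M w - E m) (v w m)\<bar> + \<epsilon>) * S.prob (cylinder w)"
      using v(2)[of w m] by (intro mult_right_mono) auto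
    ultimately show ?thesis
      by (simp add: algebra_simps)
  qed
  \<comment> \<open>Two exceptional probabilities of at most \<open>\<eta>\<close> each, multiplied
    by \<open>K\<close>, give \<open>r / 2\<close>.\<close>
  define \<eta> where "\<eta> = r / (4 * K)"
  have "0 < \<eta>"
    using assms \<open>0 < K\<close> by (simp add: \<eta>_def)
  have "(\<lambda>n. S.prob (\<Union>m<n. U m)) \<longlonglongrightarrow> S.prob (\<Union>n. \<Union>m<n. U m)"
  proof (rule S.finite_Lim_measure_incseq)
    show "incseq (\<lambda>n. \<Union>m<n. U m)"
      by (intro monoI UN_mono) auto
  qed (use U_sets in auto)
  moreover have "(\<Union>n. \<Union>m<n. U m) = space seqs"
    using U_cover by auto
  ultimately have "eventually (\<lambda>n. 1 - \<eta> < S.prob (\<Union>m<n. U m)) sequentially"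
    using \<open>0 < \<eta>\<close> by (intro order_tendstoD(1)[of _ 1]) (auto simp: S.prob_space)
  then obtain n where n: "1 - \<eta> < S.prob (\<Union>m<n. U m)"
    by (auto simp: eventually_sequentially)
  have "\<exists>N W. approx_error (U m) N W \<le> \<eta> / (real n + 1)" for m
    using cylinder_approximation[OF U_sets] \<open>0 < \<eta>\<close> by simp
  then obtain N V where NV: "\<And>m. approx_error (U m) (N m) (V m) \<le> \<eta> / (real n + 1)"
    by metis
  define N' where "N' = (\<Sum>m<n. N m)"
  have NN': "N m \<le> N'" if "m < n" for m
    unfolding N'_def using that by (intro member_le_sum) auto
  \<comment> \<open>The value \<open>n\<close> is the default when no approximating event holds; all
    such paths lie in the exceptional set \<open>B\<close>.\<close>
  define idx where "idx u = (LEAST m. m < n \<and> V m (take (N m) u) \<or> m = n)" for u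
  let ?E = "\<lambda>m. {\<omega> \<in> space seqs. \<omega> \<in> U m \<longleftrightarrow> \<not> V m (prefix (N m) \<omega>)}"
  have E_sets: "?E m \<in> sets seqs" for m
  proof -
    have eq: "?E m = (U m - {\<omega> \<in> space seqs. V m (prefix (N m) \<omega>)}) \<union> ({\<omega> \<in> space seqs. V m (prefix (N m) \<omega>)} - U m)"
      by (auto simp: U_def)
    show ?thesis
      unfolding eq by (intro sets.Un sets.Diff U_sets sets_prefix_event)
  qed
  define B where "B = (space seqs - (\<Union>m<n. U m)) \<union> (\<Union>m<n. ?E m)"
  have B_sets: "B \<in> sets seqs"
    unfolding B_def using U_sets E_sets by auto
  have "S.prob B \<le> S.prob (space seqs - (\<Union>m<n. U m)) + S.prob (\<Union>m<n. ?E m)"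
    unfolding B_def by (rule measure_Un_le) (use U_sets E_sets in auto)
  also have "\<dots> \<le> \<eta> + \<eta>"
  proof (rule add_mono)
    show "S.prob (space seqs - (\<Union>m<n. U m)) \<le> \<eta>"
      using n U_sets by (subst S.prob_compl) auto
    have "S.prob (\<Union>m<n. ?E m) \<le> (\<Sum>m<n. S.prob (?E m))"
      by (rule S.finite_measure_subadditive_finite) (use E_sets in auto)
    also have "\<dots> \<le> (\<Sum>m<n. \<eta> / (real n + 1))"
      by (rule sum_mono) (rule NV[unfolded approx_error_def])
    also have "\<dots> \<le> \<eta>"
      using \<open>0 < \<eta>\<close> by (simp add: field_simps)
    finally show "S.prob (\<Union>m<n. ?E m) \<le> \<eta>" .
  qed
  finally have B_prob: "K * S.prob B \<le> r / 2"
    using \<open>0 < K\<close> by (simp add: \<eta>_def field_simps)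
  \<comment> \<open>Outside \<open>B\<close> the path lies in some \<open>U m\<close> with
    \<open>m < n\<close> and the approximating event of \<open>m\<close> holds. So the least index
    is below \<open>n\<close>, and there too the event agrees with membership in
    \<open>U\<close>.\<close>
  have B_idx: "\<omega> \<in> B" if \<omega>: "\<omega> \<in> space seqs" "\<omega> \<notin> U (idx (prefix N' \<omega>))" for \<omega>
  proof (rule ccontr)
    assume nB: "\<omega> \<notin> B"
    then obtain m where m: "m < n" "\<omega> \<in> U m"
      using \<omega> by (auto simp: B_def)
    then have Vm: "V m (take (N m) (prefix N' \<omega>))"
      using nB \<omega> by (auto simp: B_def take_prefix NN')
    let ?i = "idx (prefix N' \<omega>)"
    have "?i \<le> m"
      unfolding idx_def by (rule Least_le) (use m Vm in auto)
    moreover have "?i < n \<and> V ?i (take (N ?i) (prefix N' \<omega>)) \<or> ?i = n"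
      unfolding idx_def by (rule LeastI_ex) auto
    ultimately have "?i < n" "V ?i (prefix (N ?i) \<omega>)"
      using m by (auto simp: take_prefix NN')
    then show False
      using nB \<omega> by (auto simp: B_def)
  qed
  show ?thesis
  proof (intro exI allI impI)
    fix L assume L: "N' \<le> L"
    let ?Z = "\<lambda>u. E (idx u)"
    have "(\<Sum>w\<in>words L. norm (M w - ?Z (take N' w)) * S.prob (cylinder w))
        \<le> (\<Sum>w\<in>words L. 2 * \<epsilon> * S.prob (cylinder w \<inter> space seqs) + K * S.prob (cylinder w \<inter> B))"
    proof (rule sum_mono)
      fix w assume w: "w \<in> words L"
      have "cylinder w - U (idx (take N' w)) \<subseteq> cylinder w \<inter> B"
        using w L B_idx take_prefix[OF L] by (auto simp: cylinder_def words_def) metis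
      then have "S.prob (cylinder w - U (idx (take N' w))) \<le> S.prob (cylinder w \<inter> B)"
        by (rule S.finite_measure_mono) (use B_sets sets_cylinder[OF w] in auto)
      moreover have "cylinder w \<inter> space seqs = cylinder w"
        by (auto simp: cylinder_def)
      ultimately show "norm (M w - ?Z (take N' w)) * S.prob (cylinder w)
          \<le> 2 * \<epsilon> * S.prob (cylinder w \<inter> space seqs) + K * S.prob (cylinder w \<inter> B)"
        using node[OF w, of "idx (take N' w)"] \<open>0 < K\<close>
        by (smt (verit) mult_left_mono)
    qed
    also have "\<dots> = 2 * \<epsilon> + K * S.prob B"
      unfolding sum.distrib sum_distrib_left[symmetric]
      by (simp only: sum_prob_cylinder_Int B_sets sets.top S.prob_space)
    also have "\<dots> \<le> r"
      using \<epsilon>(3) B_prob by simp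
    finally have "(\<Sum>w\<in>words L. norm (M w - ?Z (take N' w))) * (1 / real (card A) ^ L) \<le> r"
      by (simp add: sum_distrib_right sum_divide_distrib measure_cylinder)
    then show "(\<Sum>w\<in>words L. norm (M w - ?Z (take N' w))) \<le> r * real (card A) ^ L"
      using card_A_pos by (simp add: field_simps)
  qed
qed

text \<open>Both \<open>M (w @ [a])\<close> and \<open>M w\<close> are close in mean to the same
  \<open>Z (take N w)\<close>. Bounding one letter \<open>a\<close> by the sum over all letters
  costs a factor \<open>card A\<close>, hence the denominator of \<open>r'\<close>.\<close>

lemma mean_increment_small:
  assumes "0 < r"
  shows "\<exists>N. \<forall>L\<ge>N. \<forall>a\<in>A. norm (\<Sum>w\<in>words L. M (w @ [a]) - M w) \<le> r * real (card A) ^ L"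
proof -
  define r' where "r' = r / (real (card A) + 1)"
  have "0 < r'"
    using assms by (simp add: r'_def add_nonneg_pos)
  then obtain N Z where NZ: "\<And>L. L \<ge> N \<Longrightarrow> (\<Sum>w\<in>words L. norm (M w - Z (take N w))) \<le> r' * real (card A) ^ L"
    using averages_close_to_simple by metis
  show ?thesis
  proof (intro exI allI impI ballI)
    fix L a assume L: "N \<le> L" and a: "a \<in> A"
    have tk: "take N (w @ [b]) = take N w" if "w \<in> words L" for w b
      using that L by (simp add: words_def)
    have eq: "(\<Sum>w\<in>words L. norm (M (w @ [a]) - Z (take N w))) = (\<Sum>w\<in>words L. norm (M (w @ [a]) - Z (take N (w @ [a]))))"
      by (rule sum.cong) (simp_all only: tk)
    have "norm (\<Sum>w\<in>words L. M (w @ [a]) - M w)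
        \<le> (\<Sum>w\<in>words L. norm (M (w @ [a]) - Z (take N w)) + norm (M w - Z (take N w)))"
      by (rule sum_norm_le) (metis (no_types) diff_diff_eq2 diff_add_cancel norm_triangle_ineq4 add_diff_cancel_right)
    also have "\<dots> = (\<Sum>w\<in>words L. norm (M (w @ [a]) - Z (take N (w @ [a])))) + (\<Sum>w\<in>words L. norm (M w - Z (take N w)))"
      by (simp only: sum.distrib eq)
    also have "(\<Sum>w\<in>words L. norm (M (w @ [a]) - Z (take N (w @ [a]))))
        \<le> (\<Sum>w\<in>words L. \<Sum>b\<in>A. norm (M (w @ [b]) - Z (take N (w @ [b]))))"
      by (intro sum_mono member_le_sum[OF a, of "\<lambda>b. norm (M (_ @ [b]) - Z (take N (_ @ [b])))"]) (auto simp: finite_A)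
    also have "\<dots> \<le> r' * real (card A) ^ Suc L"
      unfolding sum_words_Suc_snoc[symmetric, of "\<lambda>w. norm (M w - Z (take N w))"] by (rule NZ) (use L in simp)
    finally have "norm (\<Sum>w\<in>words L. M (w @ [a]) - M w) \<le> r' * real (card A) ^ Suc L + r' * real (card A) ^ L"
      using NZ[OF L] by simp
    also have "\<dots> = r * real (card A) ^ L"
    proof -
      have "r = r' * (real (card A) + 1)"
        by (simp add: r'_def add_nonneg_eq_0_iff)
      then show ?thesis
        by (simp add: algebra_simps)
    qed
    finally show "norm (\<Sum>w\<in>words L. M (w @ [a]) - M w) \<le> r * real (card A) ^ L" .
  qed
qed

lemma sum_words_eq: "(\<Sum>w\<in>words L. M w) = real (card A) ^ L *\<^sub>R M []"
proof (induction L)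
  case 0
  have "words 0 = {[]}"
    by (auto simp: words_def)
  then show ?case
    by simp
next
  case (Suc L)
  have "(\<Sum>w\<in>words (Suc L). M w) = (\<Sum>w\<in>words L. real (card A) *\<^sub>R M w)"
    unfolding sum_words_Suc_snoc by (simp add: mart)
  then show ?case
    using Suc by (simp add: scaleR_sum_right[symmetric])
qed

text \<open>The mean of \<open>M\<close> over words of any fixed length is \<open>M []\<close>, so
  this follows from the smallness of the increments. It says that conditioning on one late letter
  hardly changes the expectation, uniformly in that letter.\<close>

lemma mean_last_letter:
  assumes "0 < r"
  shows "\<exists>N. \<forall>L\<ge>N. \<forall>a\<in>A.
    norm ((1 / real (card A) ^ L) *\<^sub>R (\<Sum>w\<in>words L. M (w @ [a])) - M []) \<le> r"
proof -
  obtain N where N: "\<And>L a. N \<le> L \<Longrightarrow> a \<in> A \<Longrightarrow>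
      norm (\<Sum>w\<in>words L. M (w @ [a]) - M w) \<le> r * real (card A) ^ L"
    using mean_increment_small[OF assms] by metis
  show ?thesis
  proof (intro exI allI impI ballI)
    fix L a assume "N \<le> L" "a \<in> A"
    have "(1 / real (card A) ^ L) *\<^sub>R (\<Sum>w\<in>words L. M (w @ [a])) - M []
        = (1 / real (card A) ^ L) *\<^sub>R (\<Sum>w\<in>words L. M (w @ [a]) - M w)"
      using card_A_pos by (simp add: sum_subtractf sum_words_eq scaleR_diff_right)
    then show "norm ((1 / real (card A) ^ L) *\<^sub>R (\<Sum>w\<in>words L. M (w @ [a])) - M []) \<le> r"
      using N[OF \<open>N \<le> L\<close> \<open>a \<in> A\<close>] card_A_pos by (simp add: field_simps)
  qed
qed

end

section \<open>Smearing cochains along a finitely supported measure\<close>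

text \<open>The list stands for a probability measure: repeated entries count with multiplicity, so
  convolutions are again lists.\<close>

definition mean :: "'a list \<Rightarrow> ('a \<Rightarrow> 'e::real_vector) \<Rightarrow> 'e"
  where "mean ys \<phi> = (1 / real (length ys)) *\<^sub>R (\<Sum>y\<leftarrow>ys. \<phi> y)"

lemma mean_cong: "(\<And>y. y \<in> set ys \<Longrightarrow> \<phi> y = \<psi> y) \<Longrightarrow> mean ys \<phi> = mean ys \<psi>"
  unfolding mean_def by (metis (mono_tags, lifting) map_eq_conv)

lemma mean_add: "mean ys (\<lambda>y. \<phi> y + \<psi> y) = mean ys \<phi> + mean ys \<psi>"
  by (simp add: mean_def sum_list_addf scaleR_add_right)

lemma mean_diff: "mean ys (\<lambda>y. \<phi> y - \<psi> y) = mean ys \<phi> - mean ys \<psi>"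
  by (simp add: mean_def sum_list_subtractf scaleR_diff_right)

lemma mean_const:
  assumes "ys \<noteq> []"
  shows "mean ys (\<lambda>y. x) = x"
proof -
  have "(\<Sum>y\<leftarrow>ys. x) = real (length ys) *\<^sub>R x"
    by (induction ys) (simp_all add: scaleR_left_distrib)
  then show ?thesis
    using assms by (simp add: mean_def)
qed

lemma mean_linear:
  assumes "linear T"
  shows "mean ys (\<lambda>y. T (\<phi> y)) = T (mean ys \<phi>)"
proof -
  have "(\<Sum>y\<leftarrow>ys. T (\<phi> y)) = T (\<Sum>y\<leftarrow>ys. \<phi> y)"
    by (induction ys) (simp_all add: linear_0[OF assms] linear_add[OF assms])
  then show ?thesis
    by (simp add: mean_def linear_scale[OF assms])
qed

lemma mean_swap: "mean ys (\<lambda>y. mean zs (\<lambda>z. F y z)) = mean zs (\<lambda>z. mean ys (\<lambda>y. F y z))"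
proof -
  have "(\<Sum>y\<leftarrow>ys. mean zs (F y)) = mean zs (\<lambda>z. \<Sum>y\<leftarrow>ys. F y z)"
    by (induction ys) (simp_all add: mean_add, simp add: mean_def)
  then show ?thesis
    by (simp add: mean_def[of ys] mean_linear[OF linear_scale_self])
qed

lemma norm_mean_le:
  fixes \<phi> :: "'a \<Rightarrow> 'e::real_normed_vector"
  assumes "ys \<noteq> []" "\<And>y. y \<in> set ys \<Longrightarrow> norm (\<phi> y) \<le> C"
  shows "norm (mean ys \<phi>) \<le> C"
proof -
  have "norm (\<Sum>y\<leftarrow>ys. \<phi> y) \<le> real (length ys) * C"
    using assms(2)
  proof (induction ys)
    case (Cons y ys)
    then show ?case
      using norm_triangle_ineq[of "\<phi> y" "\<Sum>y\<leftarrow>ys. \<phi> y"] by (force simp: algebra_simps)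
  qed simp
  then show ?thesis
    using assms(1) by (simp add: mean_def field_simps)
qed

section \<open>Coboundary, smearing and the prism homotopy\<close>

text \<open>The homogeneous coboundary, written by recursion without degree or carrier, so that
  identities follow by induction on the tuple with \<open>f\<close> arbitrary.\<close>

fun list_coboundary :: "('g list \<Rightarrow> 'e::real_vector) \<Rightarrow> 'g list \<Rightarrow> 'e"
  where
    "list_coboundary f [] = 0"
  | "list_coboundary f (g # gs) = f gs - list_coboundary (\<lambda>l. f (g # l)) gs"

lemma list_coboundary_diff:
  "list_coboundary (\<lambda>l. f l - h l) gs = list_coboundary f gs - list_coboundary h gs"
  by (induction gs arbitrary: f h) simp_all

lemma list_coboundary_add:
  "list_coboundary (\<lambda>l. f l + h l) gs = list_coboundary f gs + list_coboundary h gs"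
  by (induction gs arbitrary: f h) simp_all

lemma list_coboundary_mean:
  "list_coboundary (\<lambda>l. mean ys (\<lambda>y. F y l)) gs = mean ys (\<lambda>y. list_coboundary (F y) gs)"
  by (induction gs arbitrary: F) (simp_all add: mean_diff, simp add: mean_def)

text \<open>
  \<open>smear G ys f (g\<^sub>0, \<dots>)\<close> is the mean of \<open>f (g\<^sub>0 y\<^sub>0, \<dots>)\<close> over independent \<open>y\<^sub>j\<close> with the uniform law on
  the list \<open>ys\<close>, and \<open>prism\<close> is the homotopy between \<open>smear\<close> and the identity whose \<open>j\<close>-th term
  averages \<open>f (g\<^sub>0, \<dots>, g\<^sub>j, g\<^sub>j y\<^sub>j, g\<^sub>j\<^sub>+\<^sub>1 y\<^sub>j\<^sub>+\<^sub>1, \<dots>)\<close>.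
\<close>

fun smear :: "('g, 'm) monoid_scheme \<Rightarrow> 'g list \<Rightarrow> ('g list \<Rightarrow> 'e::real_vector) \<Rightarrow> 'g list \<Rightarrow> 'e"
  where
    "smear G ys f [] = f []"
  | "smear G ys f (g # gs) = mean ys (\<lambda>y. smear G ys (\<lambda>l. f ((g \<otimes>\<^bsub>G\<^esub> y) # l)) gs)"

fun prism :: "('g, 'm) monoid_scheme \<Rightarrow> 'g list \<Rightarrow> ('g list \<Rightarrow> 'e::real_vector) \<Rightarrow> 'g list \<Rightarrow> 'e"
  where
    "prism G ys f [] = 0"
  | "prism G ys f (g # gs) =
      mean ys (\<lambda>y. smear G ys (\<lambda>l. f (g # (g \<otimes>\<^bsub>G\<^esub> y) # l)) gs) - prism G ys (\<lambda>l. f (g # l)) gs"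

text \<open>The law of a product of two independent elements with laws \<open>ys\<close> and
  \<open>zs\<close>.\<close>

definition list_convolution :: "('g, 'm) monoid_scheme \<Rightarrow> 'g list \<Rightarrow> 'g list \<Rightarrow> 'g list"
  where "list_convolution G ys zs = concat (map (\<lambda>y. map (\<lambda>z. y \<otimes>\<^bsub>G\<^esub> z) zs) ys)"

lemma smear_diff: "smear G ys (\<lambda>l. f l - h l) gs = smear G ys f gs - smear G ys h gs"
  by (induction gs arbitrary: f h) (simp_all add: mean_diff)

lemma smear_linear:
  assumes "linear T"
  shows "smear G ys (\<lambda>l. T (f l)) gs = T (smear G ys f gs)"
  by (induction gs arbitrary: f) (simp_all add: mean_linear[OF assms])

lemma smear_mean: "smear G ys (\<lambda>l. mean zs (\<lambda>z. F z l)) gs = mean zs (\<lambda>z. smear G ys (F z) gs)"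
proof (induction gs arbitrary: F)
  case (Cons g gs)
  show ?case
    by (simp add: Cons mean_swap[of ys])
qed simp

lemma prism_diff: "prism G ys (\<lambda>l. f l - h l) gs = prism G ys f gs - prism G ys h gs"
  by (induction gs arbitrary: f h) (simp_all add: mean_diff smear_diff)

lemma prism_linear:
  assumes "linear T"
  shows "prism G ys (\<lambda>l. T (f l)) gs = T (prism G ys f gs)"
  by (induction gs arbitrary: f)
     (simp_all add: mean_linear[OF assms] smear_linear[OF assms] linear_0[OF assms] linear_diff[OF assms])

text \<open>An omitted argument is averaged over something independent of it, and the measure has
  total mass 1; hence smearing is a chain map.\<close>

lemma smear_list_coboundary:
  assumes "ys \<noteq> []"
  shows "smear G ys (list_coboundary f) gs = list_coboundary (smear G ys f) gs"
proof (induction gs arbitrary: f)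
  case (Cons g gs)
  show ?case
    by (simp add: smear_diff mean_diff mean_const[OF assms] Cons list_coboundary_mean)
qed simp

text \<open>Expand both summands at the first entry \<open>g\<close>: the smeared coboundary terms
  and the two copies of \<open>prism G ys f gs\<close> cancel, and the induction hypothesis for
  \<open>f (g # _)\<close> turns the remaining partial smearing into
  \<open>f (g # gs)\<close>.\<close>

lemma prism_homotopy:
  assumes "ys \<noteq> []"
  shows "list_coboundary (prism G ys f) gs + prism G ys (list_coboundary f) gs
    = smear G ys f gs - f gs"
proof (induction gs arbitrary: f)
  case (Cons g gs)
  have 1: "list_coboundary (prism G ys f) (g # gs) = prism G ys f gs
      - (mean ys (\<lambda>y. smear G ys (list_coboundary (\<lambda>l. f (g # (g \<otimes>\<^bsub>G\<^esub> y) # l))) gs)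
         - list_coboundary (prism G ys (\<lambda>l. f (g # l))) gs)"
    by (simp add: list_coboundary_diff list_coboundary_mean smear_list_coboundary[OF assms])
  have 2: "prism G ys (list_coboundary f) (g # gs) = smear G ys f (g # gs)
      - smear G ys (\<lambda>l. f (g # l)) gs
      + mean ys (\<lambda>y. smear G ys (list_coboundary (\<lambda>l. f (g # (g \<otimes>\<^bsub>G\<^esub> y) # l))) gs)
      - (prism G ys f gs - prism G ys (list_coboundary (\<lambda>l. f (g # l))) gs)"
    by (simp add: smear_diff prism_diff mean_diff mean_add mean_const[OF assms])
  show ?case
    unfolding 1 2 using Cons[of "\<lambda>l. f (g # l)"] by (simp add: algebra_simps)
qed simp

section \<open>Bounds, translations and convolutions\<close>

context group
begin

lemma smear_cong:
  assumes "set ys \<subseteq> carrier G" "set gs \<subseteq> carrier G"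
    and "\<And>l. length l = length gs \<Longrightarrow> set l \<subseteq> carrier G \<Longrightarrow> f l = h l"
  shows "smear G ys f gs = smear G ys h gs"
  using assms(2,3)
proof (induction gs arbitrary: f h)
  case (Cons g gs)
  have "smear G ys (\<lambda>l. f ((g \<otimes> y) # l)) gs = smear G ys (\<lambda>l. h ((g \<otimes> y) # l)) gs"
    if "y \<in> set ys" for y
    using Cons.prems assms(1) that by (intro Cons.IH) auto
  then show ?case
    by (simp cong: mean_cong)
qed simp

lemma prism_cong:
  assumes "set ys \<subseteq> carrier G" "set gs \<subseteq> carrier G"
    and "\<And>l. length l = Suc (length gs) \<Longrightarrow> set l \<subseteq> carrier G \<Longrightarrow> f l = h l"
  shows "prism G ys f gs = prism G ys h gs"
  using assms(2,3)
proof (induction gs arbitrary: f h)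
  case (Cons g gs)
  have "smear G ys (\<lambda>l. f (g # (g \<otimes> y) # l)) gs = smear G ys (\<lambda>l. h (g # (g \<otimes> y) # l)) gs"
    if "y \<in> set ys" for y
    using Cons.prems assms(1) that by (intro smear_cong) auto
  moreover have "prism G ys (\<lambda>l. f (g # l)) gs = prism G ys (\<lambda>l. h (g # l)) gs"
    using Cons.prems by (intro Cons.IH) auto
  ultimately show ?case
    by (simp cong: mean_cong)
qed simp

lemma norm_smear_le:
  fixes f :: "'a list \<Rightarrow> 'e::real_normed_vector"
  assumes "ys \<noteq> []" "set ys \<subseteq> carrier G" "set gs \<subseteq> carrier G"
    and "\<And>l. length l = length gs \<Longrightarrow> set l \<subseteq> carrier G \<Longrightarrow> norm (f l) \<le> C"
  shows "norm (smear G ys f gs) \<le> C"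
  using assms(3,4)
proof (induction gs arbitrary: f)
  case (Cons g gs)
  then show ?case
    using assms(2) by (auto intro!: norm_mean_le assms(1) Cons.IH)
qed simp

text \<open>There is one term for each entry of the tuple, each an average of values of
  \<open>f\<close>; the bound does not depend on the measure, which later allows weak-*
  limits.\<close>

lemma norm_prism_le:
  fixes f :: "'a list \<Rightarrow> 'e::real_normed_vector"
  assumes "ys \<noteq> []" "set ys \<subseteq> carrier G" "set gs \<subseteq> carrier G"
    and "\<And>l. length l = Suc (length gs) \<Longrightarrow> set l \<subseteq> carrier G \<Longrightarrow> norm (f l) \<le> C"
  shows "norm (prism G ys f gs) \<le> real (length gs) * C"
  using assms(3,4)
proof (induction gs arbitrary: f)
  case (Cons g gs)
  have "norm (mean ys (\<lambda>y. smear G ys (\<lambda>l. f (g # (g \<otimes> y) # l)) gs)) \<le> C"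
    using Cons.prems assms(2) by (auto intro!: norm_mean_le norm_smear_le assms(1,2))
  moreover have "norm (prism G ys (\<lambda>l. f (g # l)) gs) \<le> real (length gs) * C"
    using Cons.prems by (intro Cons.IH) auto
  ultimately show ?case
    by (simp add: algebra_simps) (smt (verit) norm_triangle_ineq4)
qed simp

text \<open>Smearing multiplies on the right and therefore commutes with left translations.\<close>

lemma smear_translate:
  assumes "\<gamma> \<in> carrier G" "set ys \<subseteq> carrier G" "set gs \<subseteq> carrier G"
  shows "smear G ys f (map (\<lambda>g. \<gamma> \<otimes> g) gs) = smear G ys (\<lambda>l. f (map (\<lambda>g. \<gamma> \<otimes> g) l)) gs"
  using assms(3)
proof (induction gs arbitrary: f)
  case (Cons g gs)
  have "smear G ys (\<lambda>l. f ((\<gamma> \<otimes> g \<otimes> y) # l)) (map (\<lambda>g. \<gamma> \<otimes> g) gs)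
      = smear G ys (\<lambda>l. f ((\<gamma> \<otimes> (g \<otimes> y)) # map (\<lambda>g. \<gamma> \<otimes> g) l)) gs" if "y \<in> set ys" for y
    using that assms Cons.prems by (subst m_assoc) (auto simp: Cons.IH)
  then show ?case
    by (simp cong: mean_cong)
qed simp

lemma prism_translate:
  assumes "\<gamma> \<in> carrier G" "set ys \<subseteq> carrier G" "set gs \<subseteq> carrier G"
  shows "prism G ys f (map (\<lambda>g. \<gamma> \<otimes> g) gs) = prism G ys (\<lambda>l. f (map (\<lambda>g. \<gamma> \<otimes> g) l)) gs"
  using assms(3)
proof (induction gs arbitrary: f)
  case (Cons g gs)
  have "smear G ys (\<lambda>l. f ((\<gamma> \<otimes> g) # (\<gamma> \<otimes> g \<otimes> y) # l)) (map (\<lambda>g. \<gamma> \<otimes> g) gs)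
      = smear G ys (\<lambda>l. f ((\<gamma> \<otimes> g) # (\<gamma> \<otimes> (g \<otimes> y)) # map (\<lambda>g. \<gamma> \<otimes> g) l)) gs"
    if "y \<in> set ys" for y
    using that assms Cons.prems by (subst m_assoc) (auto simp: smear_translate)
  then show ?case
    using Cons by (simp cong: mean_cong)
qed simp

lemma smear_singleton: "smear G [y] f gs = f (map (\<lambda>g. g \<otimes> y) gs)"
  by (induction gs arbitrary: f) (simp_all add: mean_def)

lemma list_convolution_closed:
  "set ys \<subseteq> carrier G \<Longrightarrow> set zs \<subseteq> carrier G \<Longrightarrow> set (list_convolution G ys zs) \<subseteq> carrier G"
  by (auto simp: list_convolution_def)

lemma list_convolution_Nil_iff: "list_convolution G ys zs = [] \<longleftrightarrow> ys = [] \<or> zs = []"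
  by (cases ys) (auto simp: list_convolution_def)

lemma mean_list_convolution:
  fixes \<phi> :: "'a \<Rightarrow> 'e::real_vector"
  shows "mean (list_convolution G ys zs) \<phi> = mean ys (\<lambda>y. mean zs (\<lambda>z. \<phi> (y \<otimes> z)))"
proof -
  have "length (list_convolution G ys zs) = length ys * length zs"
    by (induction ys) (simp_all add: list_convolution_def)
  moreover have "(\<Sum>x\<leftarrow>list_convolution G ys zs. \<phi> x) = (\<Sum>y\<leftarrow>ys. \<Sum>z\<leftarrow>zs. \<phi> (y \<otimes> z))"
    by (induction ys) (simp_all add: list_convolution_def comp_def)
  moreover have "(\<Sum>y\<leftarrow>ys. c *\<^sub>R \<psi> y) = c *\<^sub>R (\<Sum>y\<leftarrow>ys. \<psi> y)" for c and \<psi> :: "'a \<Rightarrow> 'e"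
    by (induction ys) (simp_all add: scaleR_add_right)
  ultimately show ?thesis
    by (simp add: mean_def)
qed

lemma smear_list_convolution:
  assumes "set ys \<subseteq> carrier G" "set zs \<subseteq> carrier G" "set gs \<subseteq> carrier G"
  shows "smear G (list_convolution G ys zs) f gs = smear G ys (smear G zs f) gs"
  using assms(3)
proof (induction gs arbitrary: f)
  case (Cons g gs)
  have "mean zs (\<lambda>z. smear G (list_convolution G ys zs) (\<lambda>l. f ((g \<otimes> (y \<otimes> z)) # l)) gs)
      = mean zs (\<lambda>z. smear G ys (smear G zs (\<lambda>l. f ((g \<otimes> y \<otimes> z) # l))) gs)" if y: "y \<in> set ys" for y
  proof (rule mean_cong)
    fix z assume z: "z \<in> set zs"
    have "g \<otimes> (y \<otimes> z) = g \<otimes> y \<otimes> z"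
      using y z assms Cons.prems by (intro m_assoc[symmetric]) auto
    then show "smear G (list_convolution G ys zs) (\<lambda>l. f ((g \<otimes> (y \<otimes> z)) # l)) gs
        = smear G ys (smear G zs (\<lambda>l. f ((g \<otimes> y \<otimes> z) # l))) gs"
      using Cons by simp
  qed
  then show ?case
    by (simp add: mean_list_convolution smear_mean cong: mean_cong)
qed simp

text \<open>Independent uniform choices in all the arguments are a single uniform choice of a word
  over \<open>bs\<close>; these words become the letters of the martingale.\<close>

lemma smear_eq_sum_words:
  assumes "distinct bs" "bs \<noteq> []"
  shows "smear G (map c bs) f gs = (1 / real (length bs) ^ length gs) *\<^sub>R
    (\<Sum>a\<in>{a. set a \<subseteq> set bs \<and> length a = length gs}. f (map2 (\<lambda>g b. g \<otimes> c b) gs a))"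
proof (induction gs arbitrary: f)
  case Nil
  have "{a. set a \<subseteq> set bs \<and> a = []} = {[]}"
    by auto
  then show ?case
    by simp
next
  case (Cons g gs)
  let ?S = "{a. set a \<subseteq> set bs \<and> length a = length gs}"
  have "{a. set a \<subseteq> set bs \<and> length a = length (g # gs)} = (\<lambda>(a, b). b # a) ` (?S \<times> set bs)"
    unfolding list.size by (simp add: lists_length_Suc_eq)
  then have "(\<Sum>a\<in>{a. set a \<subseteq> set bs \<and> length a = length (g # gs)}. f (map2 (\<lambda>g b. g \<otimes> c b) (g # gs) a))
      = (\<Sum>(a, b)\<in>?S \<times> set bs. f ((g \<otimes> c b) # map2 (\<lambda>g b. g \<otimes> c b) gs a))"
    by (simp add: sum.reindex inj_on_def case_prod_beta)
  also have "\<dots> = (\<Sum>b\<leftarrow>bs. \<Sum>a\<in>?S. f ((g \<otimes> c b) # map2 (\<lambda>g b. g \<otimes> c b) gs a))"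
    by (simp add: sum.cartesian_product[symmetric] sum.swap[of _ ?S] sum_list_distinct_conv_sum_set assms)
  finally show ?case
    by (simp add: mean_def Cons comp_def sum_list_distinct_conv_sum_set assms scaleR_sum_right)
qed

end

section \<open>Values, bounds and limits of coboundaries\<close>

text \<open>All faces of a constant tuple coincide, so the alternating sum leaves one of them or
  none according to the parity.\<close>

lemma list_coboundary_replicate:
  "list_coboundary F (replicate m g) = (if odd m then F (replicate (m - 1) g) else 0)"
proof (induction m arbitrary: F)
  case (Suc m)
  have "odd m \<Longrightarrow> g # replicate (m - 1) g = replicate m g"
    by (cases m) auto
  then show ?case
    by (simp add: Suc)
qed simp

lemma norm_list_coboundary_le:
  fixes F :: "'g list \<Rightarrow> 'e::real_normed_vector"
  assumes "\<And>l. length gs = Suc (length l) \<Longrightarrow> set l \<subseteq> set gs \<Longrightarrow> norm (F l) \<le> C"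
  shows "norm (list_coboundary F gs) \<le> real (length gs) * C"
  using assms
proof (induction gs arbitrary: F)
  case (Cons g gs)
  have "norm (F gs) \<le> C"
    by (rule Cons.prems) auto
  moreover have "norm (list_coboundary (\<lambda>l. F (g # l)) gs) \<le> real (length gs) * C"
    by (rule Cons.IH, rule Cons.prems) auto
  ultimately show ?case
    using norm_triangle_ineq4[of "F gs" "list_coboundary (\<lambda>l. F (g # l)) gs"]
    by (simp add: algebra_simps)
qed simp

lemma list_coboundary_const: "list_coboundary (\<lambda>l. c) gs = (if odd (length gs) then c else 0)"
  by (induction gs) auto

lemma list_coboundary_cong:
  assumes "\<And>l. length gs = Suc (length l) \<Longrightarrow> set l \<subseteq> set gs \<Longrightarrow> F l = F' l"
  shows "list_coboundary F gs = list_coboundary F' gs"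
  using assms
proof (induction gs arbitrary: F F')
  case (Cons g gs)
  have "F gs = F' gs"
    by (rule Cons.prems) auto
  moreover have "list_coboundary (\<lambda>l. F (g # l)) gs = list_coboundary (\<lambda>l. F' (g # l)) gs"
    by (rule Cons.IH, rule Cons.prems) auto
  ultimately show ?case
    by simp
qed simp

lemma (in dual_pairing) wconv_list_coboundary:
  assumes "\<And>l. length gs = Suc (length l) \<Longrightarrow> set l \<subseteq> set gs \<Longrightarrow> wconv (\<lambda>k. F k l) (F' l) U"
  shows "wconv (\<lambda>k. list_coboundary (F k) gs) (list_coboundary F' gs) U"
  using assms
proof (induction gs arbitrary: F F')
  case Nil
  then show ?case
    by (simp add: wconv_const)
next
  case (Cons g gs)
  have "wconv (\<lambda>k. F k gs) (F' gs) U"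
    by (rule Cons.prems) auto
  moreover have "wconv (\<lambda>k. list_coboundary (\<lambda>l. F k (g # l)) gs) (list_coboundary (\<lambda>l. F' (g # l)) gs) U"
    by (rule Cons.IH, rule Cons.prems) auto
  ultimately show ?case
    by (simp add: wconv_diff)
qed

section \<open>Bounded cocycles with coefficients in a dual module\<close>

text \<open>\<open>D_act\<close> says that \<open>act\<close> is contragredient to
  \<open>pre\<close>, which makes the action weak-* continuous.\<close>

locale dual_module = banach_module G act + dual_pairing D
  for G :: "('g, 'm) monoid_scheme" (structure)
    and act :: "'g \<Rightarrow> 'e::banach \<Rightarrow> 'e" and D :: "'e \<Rightarrow> 'f::banach \<Rightarrow> real" +
  fixes pre :: "'g \<Rightarrow> 'f \<Rightarrow> 'f"
  assumes D_act: "g \<in> carrier G \<Longrightarrow> D (act g x) v = D x (pre (inv g) v)"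
begin

lemma wconv_act:
  "g \<in> carrier G \<Longrightarrow> wconv a x U \<Longrightarrow> wconv (\<lambda>k. act g (a k)) (act g x) U"
  by (simp add: wconv_def D_act)

end

locale bounded_cocycle = dual_module G act D pre
  for G :: "('g, 'm) monoid_scheme" (structure)
    and act :: "'g \<Rightarrow> 'e::banach \<Rightarrow> 'e" and D :: "'e \<Rightarrow> 'f::banach \<Rightarrow> real"
    and pre :: "'g \<Rightarrow> 'f \<Rightarrow> 'f" +
  fixes n :: nat and f :: "'g list \<Rightarrow> 'e" and C :: real
  assumes n_pos: "0 < n"
    and f_equivariant: "\<gamma> \<in> carrier G \<Longrightarrow> l \<in> tuples G n \<Longrightarrow> f (map (\<lambda>g. \<gamma> \<otimes> g) l) = act \<gamma> (f l)"
    and f_bound: "l \<in> tuples G n \<Longrightarrow> norm (f l) \<le> C"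
    and f_cocycle: "l \<in> tuples G (Suc n) \<Longrightarrow> list_coboundary f l = 0"
begin

lemma smear_f_equivariant:
  assumes "\<gamma> \<in> carrier G" "set ys \<subseteq> carrier G" "l \<in> tuples G n"
  shows "smear G ys f (map (\<lambda>g. \<gamma> \<otimes> g) l) = act \<gamma> (smear G ys f l)"
proof -
  have "smear G ys f (map (\<lambda>g. \<gamma> \<otimes> g) l) = smear G ys (\<lambda>l. f (map (\<lambda>g. \<gamma> \<otimes> g) l)) l"
    using assms by (intro smear_translate) (auto simp: tuples_def)
  also have "\<dots> = smear G ys (\<lambda>l. act \<gamma> (f l)) l"
    using assms by (intro smear_cong f_equivariant) (auto simp: tuples_def)
  finally show ?thesis
    by (simp add: smear_linear act_linear assms)
qed

lemma prism_f_equivariant: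
  assumes "\<gamma> \<in> carrier G" "set ys \<subseteq> carrier G" "set l \<subseteq> carrier G" "length l = n"
  shows "prism G ys f (map (\<lambda>g. \<gamma> \<otimes> g) l) = act \<gamma> (prism G ys f l)"
proof -
  have "prism G ys f (map (\<lambda>g. \<gamma> \<otimes> g) l) = prism G ys (\<lambda>l. f (map (\<lambda>g. \<gamma> \<otimes> g) l)) l"
    using assms by (intro prism_translate) auto
  also have "\<dots> = prism G ys (\<lambda>l. act \<gamma> (f l)) l"
    using assms by (intro prism_cong f_equivariant) (auto simp: tuples_def)
  finally show ?thesis
    by (simp add: prism_linear act_linear assms)
qed

lemma norm_smear_f_le:
  assumes "ys \<noteq> []" "set ys \<subseteq> carrier G" "l \<in> tuples G n"
  shows "norm (smear G ys f l) \<le> C"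
  using assms by (intro norm_smear_le f_bound) (auto simp: tuples_def)

lemma norm_prism_f_le:
  assumes "ys \<noteq> []" "set ys \<subseteq> carrier G" "set l \<subseteq> carrier G" "length l = n"
  shows "norm (prism G ys f l) \<le> real n * C"
  using norm_prism_le[of ys l f C] assms f_bound by (auto simp: tuples_def)

lemma list_coboundary_prism_f:
  assumes "ys \<noteq> []" "set ys \<subseteq> carrier G" "l \<in> tuples G n"
  shows "list_coboundary (prism G ys f) l = smear G ys f l - f l"
proof -
  \<comment> \<open>The prism evaluates \<open>list_coboundary f\<close> only at tuples of
    \<open>n + 2\<close> group elements, where it vanishes; thus the norm bound holds with constant
    0.\<close>
  have "norm (prism G ys (list_coboundary f) l) \<le> real (length l) * 0"
    using assms f_cocycle by (intro norm_prism_le) (auto simp: tuples_def)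
  then show ?thesis
    using prism_homotopy[OF assms(1), of G f l] by simp
qed

text \<open>The smeared cocycle is again a cocycle, and for odd \<open>n\<close> its coboundary at
  the constant tuple of length \<open>n + 2\<close> is its value at the one of length
  \<open>n + 1\<close>.\<close>

lemma smear_f_diagonal_eq_0:
  assumes "ys \<noteq> []" "set ys \<subseteq> carrier G" "g \<in> carrier G" "odd n"
  shows "smear G ys f (replicate (Suc n) g) = 0"
proof -
  have "norm (smear G ys (list_coboundary f) (replicate (Suc (Suc n)) g)) \<le> 0"
    using assms f_cocycle by (intro norm_smear_le) (auto simp: tuples_def)
  then show ?thesis
    using assms(4) unfolding smear_list_coboundary[OF assms(1)] list_coboundary_replicate by simp
qed

end

lemma uniform_sequences_words:
  assumes "bs \<noteq> []"
  shows "uniform_sequences {a. set a \<subseteq> set bs \<and> length a = m}"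
proof
  show "finite {a. set a \<subseteq> set bs \<and> length a = m}"
    by (simp add: finite_lists_length_eq)
  have "replicate m (hd bs) \<in> {a. set a \<subseteq> set bs \<and> length a = m}"
    using assms by (auto simp: set_replicate_conv_if)
  then show "{a. set a \<subseteq> set bs \<and> length a = m} \<noteq> {}"
    by blast
qed

lemma (in uniform_sequences) sum_words_Suc_Cons:
  "(\<Sum>v\<in>words (Suc L). g v) = (\<Sum>a\<in>A. \<Sum>w\<in>words L. g (a # w))"
proof -
  have "words (Suc L) = (\<lambda>(a, w). a # w) ` (A \<times> words L)"
    by (auto simp: words_def length_Suc_conv image_iff)
  then show ?thesis
    by (simp add: sum.reindex inj_on_def case_prod_beta sum.cartesian_product)
qed

section \<open>Random products in commuting copies\<close>

locale commuting_copies = bounded_cocycle G act D pre n f C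
  for G :: "('g, 'm) monoid_scheme" (structure)
    and act :: "'g \<Rightarrow> 'e::banach \<Rightarrow> 'e" and D :: "'e \<Rightarrow> 'f::banach \<Rightarrow> real"
    and pre :: "'g \<Rightarrow> 'f \<Rightarrow> 'f" and n :: nat and f :: "'g list \<Rightarrow> 'e" and C :: real +
  fixes s :: "nat \<Rightarrow> 'g" and bs :: "'g list" and e :: "nat \<Rightarrow> 'e"
  assumes s_closed: "s i \<in> carrier G"
    and bs_closed: "set bs \<subseteq> carrier G" and bs_distinct: "distinct bs" and bs_nonempty: "bs \<noteq> []"
    and copies_commute: "j < i \<Longrightarrow> x \<in> set bs \<Longrightarrow> y \<in> set bs \<Longrightarrow>
      (s i \<otimes> x \<otimes> inv (s i)) \<otimes> (s j \<otimes> y \<otimes> inv (s j)) = (s j \<otimes> y \<otimes> inv (s j)) \<otimes> (s i \<otimes> x \<otimes> inv (s i))"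
    and dense: "0 < r \<Longrightarrow> \<exists>m. norm (z - e m) < r"
begin

definition conj_copy :: "nat \<Rightarrow> 'g \<Rightarrow> 'g"
  where "conj_copy i x = s i \<otimes> x \<otimes> inv (s i)"

text \<open>
  A letter is a choice of one element of \<open>bs\<close> for each of the \<open>n + 1\<close> arguments of the cocycle;
  the letter at position \<open>l\<close> of a word acts through the \<open>l\<close>-th commuting copy.  \<open>layers l r\<close> is
  the law of a product of independent elements of the copies \<open>l, \<dots>, l + r - 1\<close>.
\<close>

definition letters :: "'g list set"
  where "letters = {a. set a \<subseteq> set bs \<and> length a = Suc n}"

primrec layers :: "nat \<Rightarrow> nat \<Rightarrow> 'g list"
  where
    "layers l 0 = [\<one>]"
  | "layers l (Suc r) = list_convolution G (map (conj_copy l) bs) (layers (Suc l) r)"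

primrec spread :: "nat \<Rightarrow> 'g list list \<Rightarrow> 'g list \<Rightarrow> 'g list"
  where
    "spread l [] gs = gs"
  | "spread l (a # w) gs = spread (Suc l) w (map2 (\<lambda>g b. g \<otimes> conj_copy l b) gs a)"

sublocale W: uniform_sequences letters
  unfolding letters_def by (rule uniform_sequences_words[OF bs_nonempty])

lemma card_letters: "card letters = length bs ^ Suc n"
  unfolding letters_def using bs_distinct by (simp add: card_lists_length_eq distinct_card)

lemma conj_copy_closed: "x \<in> carrier G \<Longrightarrow> conj_copy i x \<in> carrier G"
  by (simp add: conj_copy_def s_closed)

lemma conj_copies_closed: "conj_copy l ` set bs \<subseteq> carrier G"
  using bs_closed conj_copy_closed by blast

lemma layers_closed: "set (layers l r) \<subseteq> carrier G"
  by (induction r arbitrary: l) (simp_all add: conj_copies_closed list_convolution_closed)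

lemma layers_nonempty: "layers l r \<noteq> []"
  by (induction r arbitrary: l) (simp_all add: list_convolution_Nil_iff bs_nonempty)

lemma multiply_letter_tuple:
  assumes "gs \<in> tuples G n" "a \<in> letters"
  shows "map2 (\<lambda>g b. g \<otimes> conj_copy l b) gs a \<in> tuples G n"
proof -
  have "g \<otimes> conj_copy l b \<in> carrier G" if "(g, b) \<in> set (zip gs a)" for g b
    using that assms set_zip_leftD[OF that] set_zip_rightD[OF that] bs_closed
    by (auto simp: tuples_def letters_def intro!: conj_copy_closed)
  then show ?thesis
    using assms by (auto simp: tuples_def letters_def)
qed

lemma spread_tuple: "set w \<subseteq> letters \<Longrightarrow> gs \<in> tuples G n \<Longrightarrow> spread l w gs \<in> tuples G n"
  by (induction w arbitrary: l gs) (simp_all add: multiply_letter_tuple)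

lemma spread_snoc:
  "spread l (w @ [a]) gs = map2 (\<lambda>g b. g \<otimes> conj_copy (l + length w) b) (spread l w gs) a"
  by (induction w arbitrary: l gs) simp_all

lemma multiply_letters_commute:
  assumes "gs \<in> tuples G n" "a \<in> letters" "h \<in> letters" "l < i"
  shows "map2 (\<lambda>g b. g \<otimes> conj_copy l b) (map2 (\<lambda>g b. g \<otimes> conj_copy i b) gs h) a
    = map2 (\<lambda>g b. g \<otimes> conj_copy i b) (map2 (\<lambda>g b. g \<otimes> conj_copy l b) gs a) h"
proof (rule nth_equalityI)
  fix k assume "k < length (map2 (\<lambda>g b. g \<otimes> conj_copy l b) (map2 (\<lambda>g b. g \<otimes> conj_copy i b) gs h) a)"
  then have k: "k < length gs" "k < length a" "k < length h"
    by auto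
  have mem: "gs ! k \<in> carrier G" "a ! k \<in> set bs" "h ! k \<in> set bs"
    using assms k nth_mem by (auto simp: tuples_def letters_def subset_iff)
  have "conj_copy i (h ! k) \<otimes> conj_copy l (a ! k) = conj_copy l (a ! k) \<otimes> conj_copy i (h ! k)"
    unfolding conj_copy_def by (rule copies_commute[OF assms(4)]) (use mem in auto)
  then have "gs ! k \<otimes> conj_copy i (h ! k) \<otimes> conj_copy l (a ! k)
      = gs ! k \<otimes> conj_copy l (a ! k) \<otimes> conj_copy i (h ! k)"
    using mem bs_closed by (simp add: m_assoc conj_copy_closed subsetD)
  then show "map2 (\<lambda>g b. g \<otimes> conj_copy l b) (map2 (\<lambda>g b. g \<otimes> conj_copy i b) gs h) a ! k
    = map2 (\<lambda>g b. g \<otimes> conj_copy i b) (map2 (\<lambda>g b. g \<otimes> conj_copy l b) gs a) h ! k"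
    using k by simp
qed (use assms in \<open>auto simp: tuples_def letters_def\<close>)

text \<open>A word starting at position \<open>l\<close> involves only copies below
  \<open>i\<close>, and these commute with copy \<open>i\<close>.\<close>

lemma spread_commute:
  assumes "set w \<subseteq> letters" "gs \<in> tuples G n" "h \<in> letters" "l + length w \<le> i"
  shows "spread l w (map2 (\<lambda>g b. g \<otimes> conj_copy i b) gs h)
    = map2 (\<lambda>g b. g \<otimes> conj_copy i b) (spread l w gs) h"
  using assms
proof (induction w arbitrary: l gs)
  case (Cons a w)
  then have "a \<in> letters" "l < i"
    by auto
  then show ?case
    using Cons by (simp add: multiply_letters_commute[of gs a h l i] multiply_letter_tuple)
qed simp

lemma smear_layer:
  assumes "gs \<in> tuples G n"
  shows "smear G (map (conj_copy l) bs) \<phi> gs = (1 / real (card letters)) *\<^sub>R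
    (\<Sum>a\<in>letters. \<phi> (map2 (\<lambda>g b. g \<otimes> conj_copy l b) gs a))"
  using assms smear_eq_sum_words[OF bs_distinct bs_nonempty, of "conj_copy l" \<phi> gs]
  unfolding card_letters by (simp add: letters_def tuples_def)

lemma smear_layers_Suc:
  assumes "gs \<in> tuples G n"
  shows "smear G (layers l (Suc r)) \<phi> gs = (1 / real (card letters)) *\<^sub>R
    (\<Sum>a\<in>letters. smear G (layers (Suc l) r) \<phi> (map2 (\<lambda>g b. g \<otimes> conj_copy l b) gs a))"
proof -
  have "smear G (layers l (Suc r)) \<phi> gs
      = smear G (map (conj_copy l) bs) (smear G (layers (Suc l) r) \<phi>) gs"
    using assms conj_copies_closed layers_closed
    by (simp add: smear_list_convolution tuples_def)
  then show ?thesis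
    by (simp add: smear_layer[OF assms])
qed

lemma smear_layers_eq_sum:
  assumes "gs \<in> tuples G n"
  shows "smear G (layers l r) \<phi> gs = (1 / real (card letters) ^ r) *\<^sub>R
    (\<Sum>w\<in>W.words r. \<phi> (spread l w gs))"
  using assms
proof (induction r arbitrary: l gs)
  case 0
  have "map (\<lambda>g. g \<otimes> \<one>) gs = gs"
    using 0 by (intro map_idI) (auto simp: tuples_def)
  moreover have "W.words 0 = {[]}"
    by (auto simp: W.words_def)
  ultimately show ?case
    by (simp add: smear_singleton)
next
  case (Suc r)
  show ?case
    unfolding smear_layers_Suc[OF Suc.prems] W.sum_words_Suc_Cons
    by (simp add: Suc.IH multiply_letter_tuple[OF Suc.prems] scaleR_sum_right)
qed

section \<open>Conditional expectations of the cocycle\<close>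

definition base :: "'g list"
  where "base = replicate (Suc n) \<one>"

lemma base_tuple: "base \<in> tuples G n"
  by (auto simp: base_def tuples_def set_replicate_conv_if)

text \<open>
  The expectation of the cocycle at products of \<open>k\<close> random letters, given that the first ones
  are \<open>w\<close>; meaningful for \<open>length w \<le> k\<close>.
\<close>

definition expect :: "nat \<Rightarrow> 'g list list \<Rightarrow> 'e"
  where "expect k w = smear G (layers (length w) (k - length w)) f (spread 0 w base)"

text \<open>For \<open>L < k\<close> the layer \<open>L\<close> is still random, and averaging over
  it first gives the martingale property up to time \<open>k\<close>.\<close>

lemma expect_step:
  assumes "w \<in> W.words L" "L < k"
  shows "real (card letters) *\<^sub>R expect k w = (\<Sum>a\<in>letters. expect k (w @ [a]))"
proof -
  have w: "length w = L" "set w \<subseteq> letters"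
    using assms by (auto simp: W.words_def)
  obtain r where r: "k - L = Suc r" "k - Suc L = r"
    using assms(2) by (metis Suc_diff_Suc)
  show ?thesis
    using W.card_A_pos
    unfolding expect_def w(1) r(1) smear_layers_Suc[OF spread_tuple[OF w(2) base_tuple]]
    by (simp add: spread_snoc w r)
qed

lemma norm_expect_le:
  assumes "w \<in> W.words L"
  shows "norm (expect k w) \<le> C"
  unfolding expect_def
  by (rule norm_smear_f_le[OF layers_nonempty layers_closed spread_tuple[OF _ base_tuple]])
     (use assms in \<open>auto simp: W.words_def\<close>)

text \<open>
  The copy \<open>i\<close> is left out: since \<open>h s\<^sub>i\<^sup>-\<^sup>1 = s\<^sub>i\<^sup>-\<^sup>1 (s\<^sub>i h s\<^sub>i\<^sup>-\<^sup>1)\<close>, multiplying by \<open>h\<close> fills this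
  gap with the letter \<open>h\<close>.
\<close>

definition other_layers :: "nat \<Rightarrow> nat \<Rightarrow> 'g list"
  where "other_layers i k =
    list_convolution G [inv (s i)] (list_convolution G (layers 0 i) (layers (Suc i) (k - Suc i)))"

lemma other_layers_closed: "set (other_layers i k) \<subseteq> carrier G"
  unfolding other_layers_def
  by (intro list_convolution_closed layers_closed) (simp add: s_closed)

lemma other_layers_nonempty: "other_layers i k \<noteq> []"
  by (simp add: other_layers_def list_convolution_Nil_iff layers_nonempty)

text \<open>Equivariance takes \<open>inv (s i)\<close> out of the cocycle. The letter
  \<open>h\<close>, now in copy \<open>i\<close>, commutes with the letters from the copies below
  \<open>i\<close> and so fills position \<open>i\<close>, while the layers above \<open>i\<close>
  stay random.\<close>

lemma smear_other_layers:
  assumes h: "h \<in> letters"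
  shows "smear G (other_layers i k) f h = act (inv (s i))
    ((1 / real (card letters) ^ i) *\<^sub>R (\<Sum>w\<in>W.words i. expect k (w @ [h])))"
proof -
  define \<phi> where "\<phi> = smear G (layers (Suc i) (k - Suc i)) f"
  define ch where "ch = map2 (\<lambda>g b. g \<otimes> conj_copy i b) base h"
  have hG: "set h \<subseteq> carrier G" "length h = Suc n"
    using h bs_closed by (auto simp: letters_def)
  have ch: "ch \<in> tuples G n"
    unfolding ch_def by (rule multiply_letter_tuple[OF base_tuple h])
  have "map (\<lambda>g. g \<otimes> inv (s i)) h = map (\<lambda>g. inv (s i) \<otimes> g) ch"
  proof (rule nth_equalityI)
    fix j assume "j < length (map (\<lambda>g. g \<otimes> inv (s i)) h)"
    then have j: "j < Suc n"
      by (simp add: hG)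
    then have "h ! j \<in> carrier G"
      using hG nth_mem by (metis subsetD)
    then have "inv (s i) \<otimes> (\<one> \<otimes> conj_copy i (h ! j)) = h ! j \<otimes> inv (s i)"
      by (simp add: conj_copy_def s_closed m_assoc[symmetric])
    then show "map (\<lambda>g. g \<otimes> inv (s i)) h ! j = map (\<lambda>g. inv (s i) \<otimes> g) ch ! j"
      using j by (simp add: ch_def base_def hG del: replicate_Suc)
  qed (simp_all add: ch_def base_def hG)
  moreover have "map (\<lambda>g. inv (s i) \<otimes> g) ch \<in> tuples G n"
    using ch by (auto simp: tuples_def s_closed)
  moreover have "smear G (other_layers i k) f h
      = smear G (list_convolution G (layers 0 i) (layers (Suc i) (k - Suc i))) f (map (\<lambda>g. g \<otimes> inv (s i)) h)"
    unfolding other_layers_def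
    by (subst smear_list_convolution)
       (use hG in \<open>simp_all add: s_closed layers_closed list_convolution_closed smear_singleton\<close>)
  ultimately have "smear G (other_layers i k) f h = smear G (layers 0 i) \<phi> (map (\<lambda>g. inv (s i) \<otimes> g) ch)"
    unfolding \<phi>_def by (simp add: smear_list_convolution layers_closed tuples_def)
  also have "\<dots> = smear G (layers 0 i) (\<lambda>l. \<phi> (map (\<lambda>g. inv (s i) \<otimes> g) l)) ch"
    using ch by (intro smear_translate layers_closed) (auto simp: s_closed tuples_def)
  also have "\<dots> = smear G (layers 0 i) (\<lambda>l. act (inv (s i)) (\<phi> l)) ch"
    unfolding \<phi>_def using ch
    by (intro smear_cong layers_closed smear_f_equivariant) (auto simp: s_closed tuples_def)
  also have "\<dots> = act (inv (s i)) (smear G (layers 0 i) \<phi> ch)"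
    by (rule smear_linear) (simp add: act_linear s_closed)
  also have "smear G (layers 0 i) \<phi> ch = (1 / real (card letters) ^ i) *\<^sub>R
      (\<Sum>w\<in>W.words i. \<phi> (spread 0 w ch))"
    by (rule smear_layers_eq_sum[OF ch])
  also have "(\<Sum>w\<in>W.words i. \<phi> (spread 0 w ch)) = (\<Sum>w\<in>W.words i. expect k (w @ [h]))"
  proof (rule sum.cong)
    fix w assume "w \<in> W.words i"
    then have w: "set w \<subseteq> letters" "length w = i"
      by (auto simp: W.words_def)
    then show "\<phi> (spread 0 w ch) = expect k (w @ [h])"
      by (simp add: expect_def \<phi>_def ch_def spread_snoc spread_commute[OF w(1) base_tuple h])
  qed simp
  finally show ?thesis .
qed


section \<open>Weak-* limits and approximate primitives\<close>

lemma expect_limit: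
  assumes U: "ultrafilter U"
  obtains E where "\<And>w. set w \<subseteq> letters \<Longrightarrow> wconv (\<lambda>k. expect k w) (E w) U"
proof -
  have "\<exists>x. set w \<subseteq> letters \<longrightarrow> wconv (\<lambda>k. expect k w) x U" for w
  proof (cases "set w \<subseteq> letters")
    case True
    then have "w \<in> W.words (length w)"
      by (simp add: W.words_def)
    then have "\<exists>x. wconv (\<lambda>k. expect k w) x U"
      by (intro wconv_exists_bounded[OF U, where C = C] norm_expect_le)
    then show ?thesis
      by simp
  qed simp
  then show ?thesis
    using that by metis
qed

text \<open>For each word the martingale identity holds for all large \<open>k\<close>, so it passes
  to the limit \<open>E\<close>, now without a time horizon; \<open>mean_last_letter\<close> applies
  to \<open>E\<close>.\<close>

lemma limit_letter_close:
  assumes U: "ultrafilter U" "U \<le> sequentially"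
    and E: "\<And>w. set w \<subseteq> letters \<Longrightarrow> wconv (\<lambda>k. expect k w) (E w) U"
    and "0 < r"
  shows "\<exists>i. \<forall>h\<in>letters.
    norm ((1 / real (card letters) ^ i) *\<^sub>R (\<Sum>w\<in>W.words i. E (w @ [h])) - E []) \<le> r"
proof -
  have U0: "U \<noteq> bot"
    using U(1) by (simp add: ultrafilter_def)
  interpret M: dual_martingale letters D E e C
  proof
    fix L w assume w: "w \<in> W.words L"
    then have wl: "set w \<subseteq> letters"
      by (simp add: W.words_def)
    have "wconv (\<lambda>k. real (card letters) *\<^sub>R expect k w) (real (card letters) *\<^sub>R E w) U"
      by (rule wconv_scaleR[OF E[OF wl]])
    moreover have "eventually (\<lambda>k. L < k) U"
      by (rule filter_leD[OF U(2) eventually_gt_at_top])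
    then have "eventually (\<lambda>k. real (card letters) *\<^sub>R expect k w = (\<Sum>a\<in>letters. expect k (w @ [a]))) U"
      by eventually_elim (rule expect_step[OF w])
    ultimately have "wconv (\<lambda>k. \<Sum>a\<in>letters. expect k (w @ [a])) (real (card letters) *\<^sub>R E w) U"
      by (rule wconv_cong)
    moreover have "wconv (\<lambda>k. \<Sum>a\<in>letters. expect k (w @ [a])) (\<Sum>a\<in>letters. E (w @ [a])) U"
      using wl by (intro wconv_sum E) auto
    ultimately show "real (card letters) *\<^sub>R E w = (\<Sum>a\<in>letters. E (w @ [a]))"
      by (rule wconv_unique[OF U0])
    show "norm (E w) \<le> C"
      by (rule norm_le_wconv[OF U0 E[OF wl]]) (simp add: norm_expect_le[OF w])
  qed (rule dense)
  show ?thesis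
    using M.mean_last_letter[OF \<open>0 < r\<close>] by blast
qed

text \<open>As \<open>k\<close> grows along an ultrafilter, the smeared cocycles and their prisms
  have weak-* limits \<open>A\<close> and \<open>P\<close>, and the coboundary of \<open>P\<close>
  is \<open>A - f\<close>. Since \<open>A\<close> is almost constant on \<open>letters\<close>, it
  is there almost the coboundary of \<open>A (hd l # l)\<close>. The bound on \<open>b\<close> is
  independent of \<open>bs\<close> and \<open>r\<close>, as the final limit over finite sets
  requires.\<close>

lemma approximate_primitive:
  assumes "0 < r"
  shows "\<exists>b. (\<forall>l. set l \<subseteq> carrier G \<longrightarrow> length l = n \<longrightarrow> norm (b l) \<le> (real n + 1) * C)
    \<and> (\<forall>\<gamma> l. \<gamma> \<in> carrier G \<longrightarrow> set l \<subseteq> carrier G \<longrightarrow> length l = n \<longrightarrow>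
        b (map (\<lambda>g. \<gamma> \<otimes> g) l) = act \<gamma> (b l))
    \<and> (\<forall>l\<in>letters. norm (list_coboundary b l - f l) \<le> r)"
proof -
  obtain U :: "nat filter" where U: "ultrafilter U" "U \<le> sequentially"
    using ultrafilter_exists[of sequentially] by auto
  then have U0: "U \<noteq> bot"
    by (simp add: ultrafilter_def)
  obtain E where E: "\<And>w. set w \<subseteq> letters \<Longrightarrow> wconv (\<lambda>k. expect k w) (E w) U"
    using expect_limit[OF U(1)] by blast
  \<comment> \<open>The \<open>n + 1\<close> faces in a coboundary cost \<open>r'\<close> each, and
    comparing the constant with \<open>A\<close> costs \<open>2 * r'\<close>.\<close>
  define r' where "r' = r / (real n + 3)"
  have r': "0 < r'" "(real n + 3) * r' = r"
    using assms by (simp_all add: r'_def)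
  \<comment> \<open>The index \<open>i\<close> is read off from the limit martingale and stays fixed
    while \<open>k\<close> varies.\<close>
  obtain i where i: "\<And>h. h \<in> letters \<Longrightarrow>
      norm ((1 / real (card letters) ^ i) *\<^sub>R (\<Sum>w\<in>W.words i. E (w @ [h])) - E []) \<le> r'"
    using limit_letter_close[OF U E r'(1)] by blast
  define Y where "Y = other_layers i"
  have Y: "Y k \<noteq> []" "set (Y k) \<subseteq> carrier G" for k
    by (simp_all add: Y_def other_layers_nonempty other_layers_closed)
  have "\<exists>x. l \<in> tuples G n \<longrightarrow> wconv (\<lambda>k. smear G (Y k) f l) x U" for l
  proof (cases "l \<in> tuples G n")
    case True
    then have "\<exists>x. wconv (\<lambda>k. smear G (Y k) f l) x U"
      by (intro wconv_exists_bounded[OF U(1), where C = C] norm_smear_f_le Y)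
    then show ?thesis
      by simp
  qed simp
  then obtain A where A: "\<And>l. l \<in> tuples G n \<Longrightarrow> wconv (\<lambda>k. smear G (Y k) f l) (A l) U"
    by metis
  have "\<exists>x. set l \<subseteq> carrier G \<and> length l = n \<longrightarrow> wconv (\<lambda>k. prism G (Y k) f l) x U" for l
  proof (cases "set l \<subseteq> carrier G \<and> length l = n")
    case True
    then have "\<exists>x. wconv (\<lambda>k. prism G (Y k) f l) x U"
      by (intro wconv_exists_bounded[OF U(1), where C = "real n * C"] norm_prism_f_le Y) auto
    then show ?thesis
      by blast
  qed blast
  then obtain P where P: "\<And>l. set l \<subseteq> carrier G \<Longrightarrow> length l = n \<Longrightarrow>
      wconv (\<lambda>k. prism G (Y k) f l) (P l) U"
    by metis
  have letters_tuples: "h \<in> tuples G n" if "h \<in> letters" for h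
    using that bs_closed by (auto simp: letters_def tuples_def)
  \<comment> \<open>Repeating the first entry raises the degree equivariantly and does not leave
    \<open>bs\<close>; it exists because \<open>n\<close> is positive.\<close>
  have dup: "hd l # l \<in> tuples G n" if "set l \<subseteq> carrier G" "length l = n" for l
  proof -
    have "hd l \<in> set l"
      using that(2) n_pos by (intro hd_in_set) auto
    then show ?thesis
      using that by (auto simp: tuples_def)
  qed
  have dup_map: "hd (map F l) # map F l = map F (hd l # l)" if "length l = n" for l :: "'g list" and F :: "'g \<Rightarrow> 'g"
    using that n_pos by (cases l) auto
  \<comment> \<open>\<open>A\<close> is nearly constant on the tuples from \<open>bs\<close>; the correction \<open>A (hd l # l)\<close> below absorbs
    this constant when \<open>n\<close> is even, and the constant is nearly 0 when \<open>n\<close> is odd.\<close>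
  define c where "c = act (inv (s i)) (E [])"
  have A_close: "norm (A h - c) \<le> r'" if h: "h \<in> letters" for h
  proof -
    let ?x = "(1 / real (card letters) ^ i) *\<^sub>R (\<Sum>w\<in>W.words i. E (w @ [h]))"
    have "wconv (\<lambda>k. smear G (Y k) f h) (act (inv (s i)) ?x) U"
      unfolding Y_def smear_other_layers[OF h]
      by (intro wconv_act wconv_scaleR wconv_sum E) (use h in \<open>auto simp: W.words_def s_closed\<close>)
    then have "A h = act (inv (s i)) ?x"
      using A[OF letters_tuples[OF h]] wconv_unique[OF U0] by blast
    then have "norm (A h - c) = norm (act (inv (s i)) (?x - E []))"
      unfolding c_def by (simp add: linear_diff[OF act_linear] s_closed)
    also have "\<dots> = norm (?x - E [])"
      by (rule act_isometric) (simp add: s_closed)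
    finally show ?thesis
      using i[OF h] by simp
  qed
  define b where "b l = A (hd l # l) - P l" for l
  have b_conv: "wconv (\<lambda>k. smear G (Y k) f (hd l # l) - prism G (Y k) f l) (b l) U"
    if "set l \<subseteq> carrier G" "length l = n" for l
    unfolding b_def by (intro wconv_diff A P dup that)
  have b_bound: "norm (b l) \<le> (real n + 1) * C" if "set l \<subseteq> carrier G" "length l = n" for l
  proof -
    have "norm (smear G (Y k) f (hd l # l) - prism G (Y k) f l) \<le> C + real n * C" for k
      by (rule order_trans[OF norm_triangle_ineq4 add_mono])
         (intro norm_smear_f_le norm_prism_f_le Y dup that)+
    then show ?thesis
      using norm_le_wconv[OF U0 b_conv[OF that], of "C + real n * C"] by (simp add: algebra_simps)
  qed
  have b_equivariant: "b (map (\<lambda>g. \<gamma> \<otimes> g) l) = act \<gamma> (b l)"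
    if \<gamma>: "\<gamma> \<in> carrier G" and l: "set l \<subseteq> carrier G" "length l = n" for \<gamma> l
  proof (rule wconv_unique[OF U0])
    let ?\<gamma>l = "map (\<lambda>g. \<gamma> \<otimes> g) l"
    show "wconv (\<lambda>k. smear G (Y k) f (hd ?\<gamma>l # ?\<gamma>l) - prism G (Y k) f ?\<gamma>l) (b ?\<gamma>l) U"
      by (rule b_conv) (use l \<gamma> in auto)
    have "smear G (Y k) f (hd ?\<gamma>l # ?\<gamma>l) - prism G (Y k) f ?\<gamma>l
        = act \<gamma> (smear G (Y k) f (hd l # l) - prism G (Y k) f l)" for k
      unfolding dup_map[OF l(2)] smear_f_equivariant[OF \<gamma> Y(2) dup[OF l]]
        prism_f_equivariant[OF \<gamma> Y(2) l]
      by (simp add: linear_diff[OF act_linear[OF \<gamma>]])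
    then show "wconv (\<lambda>k. smear G (Y k) f (hd ?\<gamma>l # ?\<gamma>l) - prism G (Y k) f ?\<gamma>l) (act \<gamma> (b l)) U"
      using wconv_act[OF \<gamma> b_conv[OF l]] by simp
  qed
  have b_coboundary: "norm (list_coboundary b l - f l) \<le> r" if l: "l \<in> letters" for l
  proof -
    have lG: "set l \<subseteq> carrier G" "length l = Suc n"
      using letters_tuples[OF l] by (auto simp: tuples_def)
    have "wconv (\<lambda>k. list_coboundary (prism G (Y k) f) l) (list_coboundary P l) U"
      by (rule wconv_list_coboundary, rule P) (use lG in auto)
    moreover have "wconv (\<lambda>k. list_coboundary (prism G (Y k) f) l) (A l - f l) U"
      unfolding list_coboundary_prism_f[OF Y letters_tuples[OF l]]
      by (intro wconv_diff A wconv_const letters_tuples l)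
    ultimately have P_cob: "list_coboundary P l = A l - f l"
      by (rule wconv_unique[OF U0])
    define a where "a l = A (hd l # l)" for l
    have "norm (list_coboundary (\<lambda>l. a l - c) l) \<le> real (length l) * r'"
    proof (rule norm_list_coboundary_le)
      fix l' assume l': "length l = Suc (length l')" "set l' \<subseteq> set l"
      then have "hd l' \<in> set l'"
        using lG n_pos by (intro hd_in_set) auto
      then have "hd l' # l' \<in> letters"
        using l l' lG(2) unfolding letters_def by (simp add: subset_iff)
      then show "norm (a l' - c) \<le> r'"
        unfolding a_def by (rule A_close)
    qed
    then have a_close: "norm (list_coboundary a l - (if odd (length l) then c else 0)) \<le> (real n + 1) * r'"
      unfolding list_coboundary_diff list_coboundary_const by (simp add: lG add.commute)
    have c_close: "norm ((if odd (length l) then c else 0) - A l) \<le> 2 * r'"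
    proof (cases "odd n")
      case False
      then show ?thesis
        using A_close[OF l] r'(1) by (simp add: lG norm_minus_commute)
    next
      case True
      \<comment> \<open>In odd degree the smeared cocycles vanish on constant tuples, hence so does
        \<open>A\<close>, and \<open>c\<close> is within \<open>r'\<close> of 0.\<close>
      define h where "h = replicate (Suc n) (hd bs)"
      have hd_bs: "hd bs \<in> set bs"
        using bs_nonempty by simp
      then have h: "h \<in> letters"
        by (auto simp: h_def letters_def)
      have "smear G (Y k) f h = 0" for k
        unfolding h_def by (rule smear_f_diagonal_eq_0[OF Y _ True]) (use hd_bs bs_closed in auto)
      then have "wconv (\<lambda>k. smear G (Y k) f h) 0 U"
        by (simp add: wconv_const)
      then have "A h = 0"
        using A[OF letters_tuples[OF h]] wconv_unique[OF U0] by blast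
      then have "norm c \<le> r'"
        using A_close[OF h] by simp
      then have "norm (A l) \<le> 2 * r'"
        using A_close[OF l] norm_triangle_ineq2[of "A l" c] by simp
      then show ?thesis
        using True by (simp add: lG)
    qed
    have "list_coboundary b l = list_coboundary a l - list_coboundary P l"
      unfolding list_coboundary_diff[symmetric] by (simp add: b_def[abs_def] a_def)
    then have "list_coboundary b l - f l = (list_coboundary a l - (if odd (length l) then c else 0))
        + ((if odd (length l) then c else 0) - A l)"
      by (simp add: P_cob)
    then have "norm (list_coboundary b l - f l) \<le> (real n + 1) * r' + 2 * r'"
      using norm_triangle_mono[OF a_close c_close] by simp
    also have "\<dots> = r"
      using r'(2) by (simp add: algebra_simps)
    finally show ?thesis .
  qed
  show ?thesis
    using b_bound b_equivariant b_coboundary by blast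
qed

end

section \<open>Vanishing\<close>

definition commuting_conjugates :: "('g, 'm) monoid_scheme \<Rightarrow> 'g set \<Rightarrow> (nat \<Rightarrow> 'g) \<Rightarrow> bool"
  where "commuting_conjugates G S s \<longleftrightarrow> (\<forall>i. s i \<in> carrier G) \<and>
    (\<forall>i j. j < i \<longrightarrow> (\<forall>x\<in>S. \<forall>y\<in>S.
      (s i \<otimes>\<^bsub>G\<^esub> x \<otimes>\<^bsub>G\<^esub> inv\<^bsub>G\<^esub> s i) \<otimes>\<^bsub>G\<^esub> (s j \<otimes>\<^bsub>G\<^esub> y \<otimes>\<^bsub>G\<^esub> inv\<^bsub>G\<^esub> s j)
      = (s j \<otimes>\<^bsub>G\<^esub> y \<otimes>\<^bsub>G\<^esub> inv\<^bsub>G\<^esub> s j) \<otimes>\<^bsub>G\<^esub> (s i \<otimes>\<^bsub>G\<^esub> x \<otimes>\<^bsub>G\<^esub> inv\<^bsub>G\<^esub> s i)))"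

text \<open>Choose the conjugators one after another, adding each to the finite set used for the
  next. For \<open>j < i\<close> the conjugate by the \<open>j\<close>-th one then lies in the
  subgroup whose conjugate by the \<open>i\<close>-th one commutes with it.\<close>

lemma (in group) commuting_conjugates_exist:
  assumes ccc: "commuting_cyclic_conjugates G" and S: "finite S" "S \<subseteq> carrier G"
  shows "\<exists>s. commuting_conjugates G S s"
proof -
  have "\<exists>t. finite Y \<and> Y \<subseteq> carrier G \<longrightarrow> t \<in> carrier G \<and>
      (\<forall>a\<in>generate G Y. \<forall>b\<in>generate G Y. a \<otimes> (t \<otimes> b \<otimes> inv t) = (t \<otimes> b \<otimes> inv t) \<otimes> a)" for Y
  proof (cases "finite Y \<and> Y \<subseteq> carrier G")
    case True
    then have "finitely_generated_subgroup G (generate G Y)"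
      by (auto simp: finitely_generated_subgroup_def)
    then obtain t n where t: "t \<in> carrier G" "(2::enat) \<le> n"
      and comm: "\<And>p::nat. 1 \<le> p \<Longrightarrow> enat p < n \<Longrightarrow>
        commuting_sets G (generate G Y) ((t [^] p <# generate G Y) #> inv (t [^] p))"
      using ccc unfolding commuting_cyclic_conjugates_def by blast
    \<comment> \<open>The exponent \<open>p = 1\<close> is admissible because
      \<open>2 \<le> n\<close>.\<close>
    have "enat 1 < n"
      using t(2) by (metis less_le_trans enat_ord_simps(2) numeral_eq_enat one_less_numeral_iff semiring_norm(76))
    then have c1: "commuting_sets G (generate G Y) ((t <# generate G Y) #> inv t)"
      using comm[of 1] t(1) by (simp add: nat_pow_eone)
    have "t \<otimes> b \<otimes> inv t \<in> (t <# generate G Y) #> inv t" if "b \<in> generate G Y" for b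
      using that by (auto simp: l_coset_def r_coset_def)
    then show ?thesis
      using t(1) c1 by (auto simp: commuting_sets_def)
  qed blast
  then obtain t where t: "\<And>Y. finite Y \<Longrightarrow> Y \<subseteq> carrier G \<Longrightarrow> t Y \<in> carrier G"
    and t_comm: "\<And>Y a b. finite Y \<Longrightarrow> Y \<subseteq> carrier G \<Longrightarrow> a \<in> generate G Y \<Longrightarrow> b \<in> generate G Y \<Longrightarrow>
      a \<otimes> (t Y \<otimes> b \<otimes> inv (t Y)) = (t Y \<otimes> b \<otimes> inv (t Y)) \<otimes> a"
    by metis
  define Y where "Y = rec_nat S (\<lambda>_ Z. insert (t Z) Z)"
  have Y_simps: "Y 0 = S" "Y (Suc i) = insert (t (Y i)) (Y i)" for i
    by (simp_all add: Y_def)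
  have Y: "finite (Y i)" "Y i \<subseteq> carrier G" for i :: nat
    by (induction i) (auto simp: Y_simps S t)
  have Y_mono: "Y i \<subseteq> Y j" if "i \<le> j" for i j
    using that by (rule lift_Suc_mono_le[of Y, rotated]) (auto simp: Y_simps)
  show ?thesis
    unfolding commuting_conjugates_def
  proof (rule exI[of _ "\<lambda>i. t (Y i)"], intro conjI allI impI ballI)
    fix i j :: nat and x y assume ij: "j < i" and xy: "x \<in> S" "y \<in> S"
    have "S \<subseteq> Y i" "S \<subseteq> Y j"
      using Y_mono[of 0] by (simp_all add: Y_simps)
    moreover have "t (Y j) \<in> Y i"
      using Y_mono[of "Suc j" i] ij by (auto simp: Y_simps)
    ultimately have mem: "t (Y j) \<in> Y i" "y \<in> Y i" "x \<in> Y i"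
      using xy by auto
    have "t (Y j) \<otimes> y \<otimes> inv (t (Y j)) \<in> generate G (Y i)" "x \<in> generate G (Y i)"
      by (rule generate.eng[OF generate.eng[OF generate.incl generate.incl] generate.inv] generate.incl mem)+
    then show "(t (Y i) \<otimes> x \<otimes> inv (t (Y i))) \<otimes> (t (Y j) \<otimes> y \<otimes> inv (t (Y j)))
        = (t (Y j) \<otimes> y \<otimes> inv (t (Y j))) \<otimes> (t (Y i) \<otimes> x \<otimes> inv (t (Y i)))"
      using t_comm[OF Y] by simp
  qed (simp add: t Y)
qed

text \<open>The pairing is evaluation through the isomorphism with the dual of \<open>pre\<close>;
  isometry gives \<open>norming\<close> and surjectivity gives \<open>representable\<close>.\<close>

lemma dual_module_of_dual_banach_module:
  fixes act :: "'g \<Rightarrow> 'e::banach \<Rightarrow> 'e" and pre :: "'g \<Rightarrow> 'f::banach \<Rightarrow> 'f"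
  assumes "dual_banach_module G act pre"
  shows "\<exists>D. dual_module G act D pre"
proof -
  from assms obtain \<Phi> where "banach_module G act" "banach_module G pre"
    and \<Phi>: "isometric_module_iso G act (contragredient G pre) \<Phi>"
    by (auto simp: dual_banach_module_def)
  interpret banach_module G act
    by fact
  interpret P: banach_module G pre
    by fact
  have lin: "linear \<Phi>" and surj: "surj \<Phi>" and iso: "\<And>x. norm (\<Phi> x) = norm x"
    and equiv: "\<And>g x. g \<in> carrier G \<Longrightarrow> \<Phi> (act g x) = contragredient G pre g (\<Phi> x)"
    using \<Phi> by (auto simp: isometric_module_iso_def bij_def)
  have "dual_module G act (\<lambda>x. blinfun_apply (\<Phi> x)) pre"
  proof (intro dual_module.intro dual_pairing.intro dual_module_axioms.intro banach_module_axioms)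
    show "linear (\<lambda>x. blinfun_apply (\<Phi> x) v)" for v
      by (rule linearI) (simp_all add: linear_add[OF lin] linear_scale[OF lin] blinfun.add_left blinfun.scaleR_left)
    show "linear (blinfun_apply (\<Phi> x))" for x
      by (rule linearI) (simp_all add: blinfun.add_right blinfun.scaleR_right)
    show "\<bar>blinfun_apply (\<Phi> x) v\<bar> \<le> norm x * norm v" for x v
      using norm_blinfun[of "\<Phi> x" v] by (simp add: iso)
    show "norm x \<le> C" if "0 \<le> C" "\<And>v. \<bar>blinfun_apply (\<Phi> x) v\<bar> \<le> C * norm v" for C x
      using norm_blinfun_bound[of C "\<Phi> x"] that by (simp add: iso)
    show "\<exists>x. \<forall>v. blinfun_apply (\<Phi> x) v = \<phi> v"
      if \<phi>: "linear \<phi>" "\<And>v. \<bar>\<phi> v\<bar> \<le> C * norm v" for \<phi> C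
    proof -
      have "bounded_linear \<phi>"
        using \<phi> by (intro bounded_linear.intro bounded_linear_axioms.intro)
          (auto intro!: exI[of _ C] simp: mult.commute)
      then have "blinfun_apply (Blinfun \<phi>) = \<phi>"
        by (rule bounded_linear_Blinfun_apply)
      then show ?thesis
        using surj by (metis surjD)
    qed
    show "blinfun_apply (\<Phi> (act g x)) v = blinfun_apply (\<Phi> x) (pre (inv\<^bsub>G\<^esub> g) v)"
      if "g \<in> carrier G" for g x v
      using that by (simp add: equiv P.contragredient_apply)
  qed
  then show ?thesis
    by blast
qed

lemma separable_dense_sequence:
  assumes "separable_space (euclidean :: 'e::real_normed_vector topology)"
  obtains e :: "nat \<Rightarrow> 'e::real_normed_vector" where "\<And>x r. 0 < r \<Longrightarrow> \<exists>m. norm (x - e m) < r"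
proof -
  obtain S :: "'e::real_normed_vector set" where S: "countable S" "closure S = UNIV"
    using assms by (auto simp: separable_space_def)
  then have "S \<noteq> {}"
    by auto
  then have range: "range (from_nat_into S) = S"
    using S(1) by (rule range_from_nat_into)
  have "\<exists>m. norm (x - from_nat_into S m) < r" if r: "0 < r" for x r
  proof -
    have "x \<in> closure S"
      by (simp add: S(2))
    then obtain y where "y \<in> S" "dist y x < r"
      using closure_approachable[of x S] r by blast
    moreover obtain m where "y = from_nat_into S m"
      using \<open>y \<in> S\<close> range by blast
    ultimately show ?thesis
      by (auto simp: dist_norm norm_minus_commute)
  qed
  then show ?thesis
    by (rule that)
qed

section \<open>The two forms of the coboundary\<close>

lemma omit_nth_Cons: "omit_nth 0 (g # gs) = gs" "omit_nth (Suc i) (g # gs) = g # omit_nth i gs"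
  by (simp_all add: omit_nth_def)

lemma list_coboundary_eq_sum:
  "list_coboundary f gs = (\<Sum>i<length gs. (- 1) ^ i *\<^sub>R f (omit_nth i gs))"
proof (induction gs arbitrary: f)
  case (Cons g gs)
  show ?case
    by (simp add: Cons sum.lessThan_Suc_shift omit_nth_Cons sum_negf del: sum.lessThan_Suc)
qed simp

lemma coboundary_eq_list_coboundary:
  "coboundary G k f gs = (if gs \<in> tuples G (Suc k) then list_coboundary f gs else 0)"
  by (auto simp: coboundary_def list_coboundary_eq_sum tuples_def lessThan_Suc_atMost)

section \<open>Exact primitives\<close>

text \<open>Approximate primitives for finite sets \<open>S\<close> and errors
  \<open>1 / (j + 1)\<close> share one norm bound. A weak-* limit keeps the bound and the
  equivariance, and its coboundary differs from \<open>f\<close> by less than any error.\<close>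

lemma (in bounded_cocycle) primitive_exists:
  assumes ccc: "commuting_cyclic_conjugates G"
    and sep: "separable_space (euclidean :: 'e topology)"
  shows "\<exists>b. (\<forall>l. set l \<subseteq> carrier G \<longrightarrow> length l = n \<longrightarrow> norm (b l) \<le> (real n + 1) * C)
    \<and> (\<forall>\<gamma> l. \<gamma> \<in> carrier G \<longrightarrow> set l \<subseteq> carrier G \<longrightarrow> length l = n \<longrightarrow>
        b (map (\<lambda>g. \<gamma> \<otimes> g) l) = act \<gamma> (b l))
    \<and> (\<forall>l\<in>tuples G n. list_coboundary b l = f l)"
proof -
  obtain e :: "nat \<Rightarrow> 'e" where e: "\<And>x r. 0 < r \<Longrightarrow> \<exists>m. norm (x - e m) < r"
    using separable_dense_sequence[OF sep] by blast
  define good where "good S j b \<longleftrightarrow>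
    (\<forall>l. set l \<subseteq> carrier G \<longrightarrow> length l = n \<longrightarrow> norm (b l) \<le> (real n + 1) * C)
    \<and> (\<forall>\<gamma> l. \<gamma> \<in> carrier G \<longrightarrow> set l \<subseteq> carrier G \<longrightarrow> length l = n \<longrightarrow>
        b (map (\<lambda>g. \<gamma> \<otimes> g) l) = act \<gamma> (b l))
    \<and> (\<forall>l. set l \<subseteq> S \<longrightarrow> length l = Suc n \<longrightarrow> norm (list_coboundary b l - f l) \<le> 1 / real (Suc j))"
    for S and j :: nat and b
  have "\<exists>b. finite S \<and> S \<subseteq> carrier G \<longrightarrow> good S j b" for S j
  proof (cases "finite S \<and> S \<subseteq> carrier G")
    case True
    \<comment> \<open>Adding \<open>\<one>\<close> ensures that the list \<open>bs\<close> is
      nonempty even if \<open>S\<close> is empty.\<close>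
    then have S: "finite (insert \<one> S)" "insert \<one> S \<subseteq> carrier G"
      by auto
    obtain s where s: "commuting_conjugates G (insert \<one> S) s"
      using commuting_conjugates_exist[OF ccc S] by blast
    obtain bs where bs: "set bs = insert \<one> S" "distinct bs"
      using finite_distinct_list[OF S(1)] by blast
    interpret commuting_copies G act D pre n f C s bs e
    proof
      show "s i \<in> carrier G" for i
        using s by (simp add: commuting_conjugates_def)
      show "set bs \<subseteq> carrier G" "distinct bs"
        using bs S by simp_all
      show "bs \<noteq> []"
        using bs(1) by auto
      show "(s i \<otimes> x \<otimes> inv (s i)) \<otimes> (s j \<otimes> y \<otimes> inv (s j)) = (s j \<otimes> y \<otimes> inv (s j)) \<otimes> (s i \<otimes> x \<otimes> inv (s i))"
        if "j < i" "x \<in> set bs" "y \<in> set bs" for i j x y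
        using s that unfolding bs(1) commuting_conjugates_def by blast
      show "\<exists>m. norm (z - e m) < r" if "0 < r" for z r
        using that by (rule e)
    qed
    obtain b where b: "\<forall>l. set l \<subseteq> carrier G \<longrightarrow> length l = n \<longrightarrow> norm (b l) \<le> (real n + 1) * C"
      "\<forall>\<gamma> l. \<gamma> \<in> carrier G \<longrightarrow> set l \<subseteq> carrier G \<longrightarrow> length l = n \<longrightarrow> b (map (\<lambda>g. \<gamma> \<otimes> g) l) = act \<gamma> (b l)"
      "\<forall>l\<in>letters. norm (list_coboundary b l - f l) \<le> 1 / real (Suc j)"
      using approximate_primitive[of "1 / real (Suc j)"] by auto
    have "good S j b"
      unfolding good_def using b by (auto simp: letters_def bs)
    then show ?thesis
      by blast
  qed blast
  then obtain b where good: "\<And>S j. finite S \<Longrightarrow> S \<subseteq> carrier G \<Longrightarrow> good S j (b S j)"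
    by metis
  \<comment> \<open>Along \<open>F\<close> the finite set grows and the error shrinks at the same
    time.\<close>
  define F where "F = finite_subsets_at_top (carrier G) \<times>\<^sub>F (sequentially :: nat filter)"
  have "F \<noteq> bot"
    by (simp add: F_def prod_filter_eq_bot)
  then obtain U where U: "ultrafilter U" "U \<le> F"
    by (rule ultrafilter_exists)
  then have U0: "U \<noteq> bot"
    by (simp add: ultrafilter_def)
  have ev_good: "eventually (\<lambda>(S, j). good S j (b S j) \<and> T \<subseteq> S \<and> j0 \<le> j) U"
    if T: "finite T" "T \<subseteq> carrier G" for T and j0 :: nat
  proof (rule filter_leD[OF U(2)])
    have "eventually (\<lambda>S. finite S \<and> T \<subseteq> S \<and> S \<subseteq> carrier G) (finite_subsets_at_top (carrier G))"
      using T by (auto simp: eventually_finite_subsets_at_top)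
    then have "eventually (\<lambda>p. (finite (fst p) \<and> T \<subseteq> fst p \<and> fst p \<subseteq> carrier G) \<and> j0 \<le> snd p) F"
      unfolding F_def
      by (intro eventually_prodI eventually_ge_at_top)
    then show "eventually (\<lambda>(S, j). good S j (b S j) \<and> T \<subseteq> S \<and> j0 \<le> j) F"
      by (rule eventually_mono) (auto intro: good)
  qed
  have ev_bound: "eventually (\<lambda>p. norm (case p of (S, j) \<Rightarrow> b S j l) \<le> (real n + 1) * C) U"
    if "set l \<subseteq> carrier G" "length l = n" for l
    using ev_good[of "{}" 0] by (rule eventually_mono) (use that in \<open>auto simp: good_def\<close>)
  have "\<exists>x. set l \<subseteq> carrier G \<and> length l = n \<longrightarrow> wconv (\<lambda>(S, j). b S j l) x U" for l
  proof (cases "set l \<subseteq> carrier G \<and> length l = n")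
    case True
    then obtain x where "wconv (\<lambda>(S, j). b S j l) x U"
      using wconv_exists[OF U(1) ev_bound, of l] by blast
    then show ?thesis
      by blast
  qed blast
  then obtain B where B: "\<And>l. set l \<subseteq> carrier G \<Longrightarrow> length l = n \<Longrightarrow> wconv (\<lambda>(S, j). b S j l) (B l) U"
    by metis
  have "norm (B l) \<le> (real n + 1) * C" if "set l \<subseteq> carrier G" "length l = n" for l
    by (rule norm_le_wconv[OF U0 B[OF that] ev_bound[OF that]])
  moreover have "B (map (\<lambda>g. \<gamma> \<otimes> g) l) = act \<gamma> (B l)"
    if \<gamma>: "\<gamma> \<in> carrier G" and l: "set l \<subseteq> carrier G" "length l = n" for \<gamma> l
  proof (rule wconv_unique[OF U0])
    show "wconv (\<lambda>(S, j). b S j (map (\<lambda>g. \<gamma> \<otimes> g) l)) (B (map (\<lambda>g. \<gamma> \<otimes> g) l)) U"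
      by (rule B) (use \<gamma> l in auto)
    have "eventually (\<lambda>p. act \<gamma> (case p of (S, j) \<Rightarrow> b S j l) = (case p of (S, j) \<Rightarrow> b S j (map (\<lambda>g. \<gamma> \<otimes> g) l))) U"
      using ev_good[of "{}" 0] by (rule eventually_mono) (use \<gamma> l in \<open>auto simp: good_def\<close>)
    then show "wconv (\<lambda>(S, j). b S j (map (\<lambda>g. \<gamma> \<otimes> g) l)) (act \<gamma> (B l)) U"
      by (rule wconv_cong[OF wconv_act[OF \<gamma> B[OF l]]])
  qed
  moreover have "list_coboundary B l = f l" if l: "l \<in> tuples G n" for l
  proof -
    have lG: "set l \<subseteq> carrier G" "length l = Suc n"
      using l by (auto simp: tuples_def)
    have "wconv (\<lambda>p. list_coboundary (\<lambda>l'. case p of (S, j) \<Rightarrow> b S j l') l) (list_coboundary B l) U"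
      by (rule wconv_list_coboundary, rule B) (use lG in auto)
    then have conv: "wconv (\<lambda>p. list_coboundary (\<lambda>l'. case p of (S, j) \<Rightarrow> b S j l') l - f l)
        (list_coboundary B l - f l) U"
      by (intro wconv_diff wconv_const)
    have "norm (list_coboundary B l - f l) \<le> 1 / real (Suc j)" for j
    proof (rule norm_le_wconv[OF U0 conv])
      show "eventually (\<lambda>p. norm (list_coboundary (\<lambda>l'. case p of (S, j) \<Rightarrow> b S j l') l - f l) \<le> 1 / real (Suc j)) U"
        using ev_good[of "set l" j]
      proof (rule eventually_mono)
        fix p assume p: "case p of (S, i) \<Rightarrow> good S i (b S i) \<and> set l \<subseteq> S \<and> j \<le> i"
        obtain S i where Si: "p = (S, i)"
          by fastforce
        have "norm (list_coboundary (b S i) l - f l) \<le> 1 / real (Suc i)"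
          using p lG by (auto simp: good_def Si)
        also have "\<dots> \<le> 1 / real (Suc j)"
          using p by (auto simp: Si intro!: divide_left_mono)
        finally show "norm (list_coboundary (\<lambda>l'. case p of (S, j) \<Rightarrow> b S j l') l - f l) \<le> 1 / real (Suc j)"
          by (simp add: Si)
      qed (use lG in auto)
    qed
    then have "norm (list_coboundary B l - f l) \<le> 0"
      by (intro LIMSEQ_le_const[OF LIMSEQ_inverse_real_of_nat]) (auto simp: inverse_eq_divide)
    then show ?thesis
      by simp
  qed
  ultimately show ?thesis
    by blast
qed

section \<open>Groups of cochains and the cohomology quotient\<close>

context banach_module
begin

lemma coboundary_in_invariant_cochains:
  assumes "b \<in> carrier (invariant_cochains G act k)"
  shows "coboundary G k b \<in> carrier (invariant_cochains G act (Suc k))"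
proof -
  obtain C where C: "\<And>l. l \<in> tuples G k \<Longrightarrow> norm (b l) \<le> C"
    using assms by (auto simp: invariant_cochains_def bounded_cochains_def bounded_iff)
  have inv_b: "act \<gamma> (b (map (\<lambda>g. inv \<gamma> \<otimes> g) l)) = b l" if "\<gamma> \<in> carrier G" "l \<in> tuples G k" for \<gamma> l
  proof -
    have "cochain_act G act k \<gamma> b = b"
      using assms that by (auto simp: invariant_cochains_def)
    then show ?thesis
      using that by (metis cochain_act_def)
  qed
  have "norm (coboundary G k b gs) \<le> real (Suc (Suc k)) * C" if "gs \<in> tuples G (Suc k)" for gs
    using that norm_list_coboundary_le[of gs b C] C
    by (auto simp: coboundary_eq_list_coboundary tuples_def)
  then have "coboundary G k b \<in> bounded_cochains G (Suc k)"
    by (auto simp: bounded_cochains_def bounded_iff coboundary_def)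
  moreover have "cochain_act G act (Suc k) \<gamma> (coboundary G k b) = coboundary G k b" if \<gamma>: "\<gamma> \<in> carrier G" for \<gamma>
  proof
    fix gs
    show "cochain_act G act (Suc k) \<gamma> (coboundary G k b) gs = coboundary G k b gs"
    proof (cases "gs \<in> tuples G (Suc k)")
      case True
      have om: "omit_nth i (map (\<lambda>g. inv \<gamma> \<otimes> g) gs) = map (\<lambda>g. inv \<gamma> \<otimes> g) (omit_nth i gs)" for i
        by (simp add: omit_nth_def take_map drop_map)
      have "map (\<lambda>g. inv \<gamma> \<otimes> g) gs \<in> tuples G (Suc k)"
        using True \<gamma> by (auto simp: tuples_def)
      moreover have "act \<gamma> (\<Sum>i\<le>Suc k. (- 1) ^ i *\<^sub>R b (map (\<lambda>g. inv \<gamma> \<otimes> g) (omit_nth i gs)))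
          = (\<Sum>i\<le>Suc k. (- 1) ^ i *\<^sub>R b (omit_nth i gs))"
        unfolding linear_sum[OF act_linear[OF \<gamma>]]
        by (rule sum.cong) (simp_all add: linear_scale[OF act_linear[OF \<gamma>]] inv_b \<gamma> omit_nth_tuples[OF True] del: sum.atMost_Suc)
      ultimately show ?thesis
        using True by (simp add: cochain_act_def coboundary_def om del: sum.atMost_Suc)
    qed (simp add: cochain_act_def coboundary_def)
  qed
  ultimately show ?thesis
    by (simp add: invariant_cochains_def)
qed

lemma comm_group_invariant_cochains: "comm_group (invariant_cochains G act k)"
proof (rule comm_groupI)
  let ?I = "invariant_cochains G act k"
  show "\<one>\<^bsub>?I\<^esub> \<in> carrier ?I"
    by (auto simp: invariant_cochains_def bounded_cochains_def cochain_act_def linear_0[OF act_linear]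
        image_constant_conv)
  fix f h assume f: "f \<in> carrier ?I" and h: "h \<in> carrier ?I"
  have act_add: "cochain_act G act k \<gamma> (\<lambda>gs. f gs + h gs) = (\<lambda>gs. f gs + h gs)" if "\<gamma> \<in> carrier G" for \<gamma>
  proof -
    have "cochain_act G act k \<gamma> f = f" "cochain_act G act k \<gamma> h = h"
      using f h that by (auto simp: invariant_cochains_def)
    then show ?thesis
      unfolding cochain_act_def fun_eq_iff
      by (simp add: linear_add[OF act_linear[OF that]]) (metis add.right_neutral)
  qed
  have "bounded ((\<lambda>gs. f gs + h gs) ` tuples G k)"
    using f h by (auto simp: invariant_cochains_def bounded_cochains_def intro: bounded_plus_comp)
  then show "f \<otimes>\<^bsub>?I\<^esub> h \<in> carrier ?I"
    using f h act_add by (auto simp: invariant_cochains_def bounded_cochains_def)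
  show "\<exists>h\<in>carrier ?I. h \<otimes>\<^bsub>?I\<^esub> f = \<one>\<^bsub>?I\<^esub>"
  proof
    show "(\<lambda>gs. - f gs) \<otimes>\<^bsub>?I\<^esub> f = \<one>\<^bsub>?I\<^esub>"
      by (simp add: invariant_cochains_def)
    have "cochain_act G act k \<gamma> (\<lambda>gs. - f gs) = (\<lambda>gs. - f gs)" if "\<gamma> \<in> carrier G" for \<gamma>
    proof -
      have "cochain_act G act k \<gamma> f = f"
        using f that by (auto simp: invariant_cochains_def)
      then show ?thesis
        unfolding cochain_act_def fun_eq_iff
        by (simp add: linear_neg[OF act_linear[OF that]]) (metis neg_0_equal_iff_equal)
    qed
    then show "(\<lambda>gs. - f gs) \<in> carrier ?I"
      using f by (auto simp: invariant_cochains_def bounded_cochains_def bounded_iff)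
  qed
qed (auto simp: invariant_cochains_def algebra_simps)

end

text \<open>Used for the group of cocycles, once every cocycle is known to be a coboundary.\<close>

lemma (in group) trivial_group_Mod_carrier: "trivial_group (G Mod carrier G)"
proof -
  have N: "carrier G \<lhd> G"
    by (rule normal_invI) (auto simp: subgroup_self)
  have "carrier G #> x = carrier G" if "x \<in> carrier G" for x
    using that by (simp add: coset_join2 subgroup_self)
  then have "carrier (G Mod carrier G) = {\<one>\<^bsub>G Mod carrier G\<^esub>}"
    by (auto simp: FactGroup_def RCOSETS_def)
  then show ?thesis
    using normal.factorgroup_is_group[OF N] by (simp add: trivial_group_def)
qed

lemma (in banach_module) group_bounded_cocycles:
  "group ((invariant_cochains G act k)\<lparr>carrier := bounded_cocycles G act k\<rparr>)"
proof -
  let ?I = "\<lambda>k. invariant_cochains G act k"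
  have "group_hom (?I k) (?I (Suc k)) (coboundary G k)"
  proof (intro group_hom.intro group_hom_axioms.intro homI)
    show "group (?I k)" "group (?I (Suc k))"
      using comm_group_invariant_cochains by (auto simp: comm_group_def)
    show "coboundary G k (f \<otimes>\<^bsub>?I k\<^esub> h) = coboundary G k f \<otimes>\<^bsub>?I (Suc k)\<^esub> coboundary G k h" for f h
      by (auto simp: invariant_cochains_def coboundary_eq_list_coboundary list_coboundary_add)
  qed (rule coboundary_in_invariant_cochains)
  then have "subgroup (bounded_cocycles G act k) (?I k)"
    unfolding bounded_cocycles_def by (rule group_hom.subgroup_kernel)
  then show ?thesis
    using comm_group_invariant_cochains by (auto simp: comm_group_def intro: subgroup.subgroup_is_group)
qed

theorem theorem1p3:
  fixes G :: "('g, 'm) monoid_scheme"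
    and act :: "'g \<Rightarrow> 'e::banach \<Rightarrow> 'e"
    and pre :: "'g \<Rightarrow> 'f::banach \<Rightarrow> 'f"
    and n :: nat
  assumes "group G"
    and "commuting_cyclic_conjugates G"
    and "dual_banach_module G act pre"
    and "separable_space (euclidean :: 'e topology)"
    and "n \<ge> 1"
  shows "trivial_group (bounded_cohomology G act n)"
proof -
  obtain D where "dual_module G act D pre"
    using dual_module_of_dual_banach_module[OF assms(3)] by blast
  then interpret dual_module G act D pre .
  obtain m where n: "n = Suc m"
    using assms(5) by (cases n) auto
  have "bounded_coboundaries G act n = bounded_cocycles G act n"
  proof (intro equalityI subsetI)
    fix f assume "f \<in> bounded_coboundaries G act n"
    then show "f \<in> bounded_cocycles G act n"
      using coboundary_in_invariant_cochains
      by (auto simp: bounded_coboundaries_def bounded_cocycles_def n kernel_def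
          coboundary_coboundary invariant_cochains_def[of _ _ "Suc (Suc m)"])
  next
    fix f assume f: "f \<in> bounded_cocycles G act n"
    then have f_inv: "\<And>\<gamma>. \<gamma> \<in> carrier G \<Longrightarrow> cochain_act G act n \<gamma> f = f"
      and f_zero: "\<And>l. l \<notin> tuples G n \<Longrightarrow> f l = 0"
      and f_cob: "coboundary G n f = (\<lambda>gs. 0)"
      by (auto simp: bounded_cocycles_def kernel_def invariant_cochains_def bounded_cochains_def)
    obtain C where C: "\<And>l. l \<in> tuples G n \<Longrightarrow> norm (f l) \<le> C"
      using f by (auto simp: bounded_cocycles_def kernel_def invariant_cochains_def
          bounded_cochains_def bounded_iff)
    have cancel: "map (\<lambda>g. inv\<^bsub>G\<^esub> \<gamma> \<otimes>\<^bsub>G\<^esub> g) (map (\<lambda>g. \<gamma> \<otimes>\<^bsub>G\<^esub> g) l) = l"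
      if "\<gamma> \<in> carrier G" "set l \<subseteq> carrier G" for \<gamma> l
      using that by (auto simp: m_assoc[symmetric] intro!: map_idI)
    interpret bounded_cocycle G act D pre n f C
    proof
      fix \<gamma> l assume \<gamma>: "\<gamma> \<in> carrier G" and l: "l \<in> tuples G n"
      have "map (\<lambda>g. \<gamma> \<otimes>\<^bsub>G\<^esub> g) l \<in> tuples G n"
        using \<gamma> l by (auto simp: tuples_def)
      \<comment> \<open>Invariance gives \<open>f l = act \<gamma> (f (inv \<gamma> l))\<close>;
        evaluated at the translate of \<open>l\<close> by \<open>\<gamma>\<close>, it is
        equivariance.\<close>
      then show "f (map (\<lambda>g. \<gamma> \<otimes>\<^bsub>G\<^esub> g) l) = act \<gamma> (f l)"
        using fun_cong[OF f_inv[OF \<gamma>], of "map (\<lambda>g. \<gamma> \<otimes>\<^bsub>G\<^esub> g) l"] cancel[OF \<gamma>, of l] l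
        by (simp add: cochain_act_def tuples_def)
    next
      fix l assume "l \<in> tuples G (Suc n)"
      then show "list_coboundary f l = 0"
        using fun_cong[OF f_cob, of l] by (simp add: coboundary_eq_list_coboundary)
    qed (use n C in auto)
    obtain b where b_bound: "\<And>l. set l \<subseteq> carrier G \<Longrightarrow> length l = n \<Longrightarrow> norm (b l) \<le> (real n + 1) * C"
      and b_equivariant: "\<And>\<gamma> l. \<gamma> \<in> carrier G \<Longrightarrow> set l \<subseteq> carrier G \<Longrightarrow> length l = n \<Longrightarrow>
        b (map (\<lambda>g. \<gamma> \<otimes>\<^bsub>G\<^esub> g) l) = act \<gamma> (b l)"
      and b_cob: "\<And>l. l \<in> tuples G n \<Longrightarrow> list_coboundary b l = f l"
      using primitive_exists[OF assms(2,4)] by blast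
    \<comment> \<open>The primitive is controlled only on tuples over the carrier, whereas a cochain
      must be 0 elsewhere; the cutoff leaves its coboundary on tuples unchanged.\<close>
    define b' where "b' l = (if l \<in> tuples G m then b l else 0)" for l
    have "b' \<in> bounded_cochains G m"
      using b_bound by (auto simp: bounded_cochains_def bounded_iff b'_def tuples_def n)
    moreover have "cochain_act G act m \<gamma> b' = b'" if \<gamma>: "\<gamma> \<in> carrier G" for \<gamma>
    proof
      fix l
      show "cochain_act G act m \<gamma> b' l = b' l"
      proof (cases "l \<in> tuples G m")
        case True
        then have l: "set l \<subseteq> carrier G" "length l = n"
          by (auto simp: tuples_def n)
        have "map (\<lambda>g. inv\<^bsub>G\<^esub> \<gamma> \<otimes>\<^bsub>G\<^esub> g) l \<in> tuples G m"
          using True \<gamma> by (auto simp: tuples_def)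
        moreover have "act \<gamma> (act (inv\<^bsub>G\<^esub> \<gamma>) x) = x" for x
          using \<gamma> by (simp add: act_mult[symmetric] act_one)
        ultimately show ?thesis
          using True \<gamma> b_equivariant[OF _ l, of "inv\<^bsub>G\<^esub> \<gamma>"] by (simp add: cochain_act_def b'_def)
      qed (simp add: cochain_act_def b'_def)
    qed
    ultimately have "b' \<in> carrier (invariant_cochains G act m)"
      by (simp add: invariant_cochains_def)
    moreover have "coboundary G m b' = f"
    proof
      fix l
      show "coboundary G m b' l = f l"
      proof (cases "l \<in> tuples G n")
        case True
        then have "list_coboundary b' l = list_coboundary b l"
          by (intro list_coboundary_cong) (auto simp: b'_def tuples_def n)
        then show ?thesis
          using True b_cob[OF True] by (simp add: coboundary_eq_list_coboundary n)
      next
        case False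
        then show ?thesis
          using f_zero[OF False] by (simp add: coboundary_def n)
      qed
    qed
    ultimately show "f \<in> bounded_coboundaries G act n"
      by (auto simp: bounded_coboundaries_def n)
  qed
  then show ?thesis
    using group.trivial_group_Mod_carrier[OF group_bounded_cocycles[of n]]
    by (simp add: bounded_cohomology_def)
qed

end
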